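(* Let $q\ge1$, let $A=(a_1,\ldots,a_q)$, $B=(b_1,\ldots,b_q)$ be real vectors with $B\prec^W A$, and let $0<\sigma\le1$. Then the functions $$ z\mapsto{}_{q+1}F_q(\sigma,A;B;z)\quad\text{and}\quad z\mapsto z\,{}_{q+1}F_q(\sigma,A;B;z) $$ are univalent in the half-plane $\Re(z)<1$. The second function is also starlike in the disk $|z|<r^*$, where $$ r^*=\sqrt{13\sqrt{13}-46}\approx0.934. $$
   Context: $B\prec^W A$ means: $0<a_1\le\cdots\le a_q$, $0<b_1\le\cdots\le b_q$, and $\sum_{i=1}^{k}a_i\le\sum_{i=1}^{k}b_i$ for $k=1,\ldots,q$. The generalized hypergeometric function is ${}_{q+1}F_q(\sigma,A;B;z)=\sum_{n=0}^{\infty}\frac{(\sigma)_n(a_1)_n\cdots(a_q)_n}{(b_1)_n\cdots(b_q)_n\,n!}z^n$ for $|z|<1$, extended by analytic continuation to $\mathbb{C}\setminus[1,\infty)$; $(a)_0=1$, $(a)_n=a(a+1)\cdots(a+n-1)$. Univalent means holomorphic and injective. A function $g$ with $g(0)=0$ is starlike in a disk $|z|<r$ if it is univalent there and maps the disk onto a domain starlike with respect to the origin. *)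

theory Defs
  imports "HOL-Complex_Analysis.Complex_Analysis"
begin

text \<open>
  Vectors of length \<open>q\<close> are functions \<open>nat \<Rightarrow> real\<close> of which only the values at
  \<open>1, \<dots>, q\<close> are used. In \<open>weak_supermajorized q b a\<close> the arguments come in the order of
  \<open>B \<prec>\<^sup>W A\<close>; positivity and the increasing arrangement are part of the relation.
\<close>

definition weak_supermajorized :: "nat \<Rightarrow> (nat \<Rightarrow> real) \<Rightarrow> (nat \<Rightarrow> real) \<Rightarrow> bool" where
  "weak_supermajorized q b a \<longleftrightarrow>
     0 < a 1 \<and> mono_on {1..q} a \<and>
     0 < b 1 \<and> mono_on {1..q} b \<and>
     (\<forall>k\<in>{1..q}. (\<Sum>i=1..k. a i) \<le> (\<Sum>i=1..k. b i))"

definition hypergeom_coeff ::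
  "nat \<Rightarrow> real \<Rightarrow> (nat \<Rightarrow> real) \<Rightarrow> (nat \<Rightarrow> real) \<Rightarrow> nat \<Rightarrow> real" where
  "hypergeom_coeff q \<sigma> a b n =
     pochhammer \<sigma> n * (\<Prod>i=1..q. pochhammer (a i) n) /
     ((\<Prod>i=1..q. pochhammer (b i) n) * fact n)"

definition slit_plane :: "complex set" where
  "slit_plane = - (complex_of_real ` {1..})"

definition is_hypergeom_continuation ::
  "nat \<Rightarrow> real \<Rightarrow> (nat \<Rightarrow> real) \<Rightarrow> (nat \<Rightarrow> real) \<Rightarrow> (complex \<Rightarrow> complex) \<Rightarrow> bool" where
  "is_hypergeom_continuation q \<sigma> a b F \<longleftrightarrow>
     F holomorphic_on slit_plane \<and>
     (\<forall>z\<in>ball 0 1. (\<lambda>n. complex_of_real (hypergeom_coeff q \<sigma> a b n) * z ^ n) sums F z)"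

text \<open>
  The values on the slit plane do not depend on the choice (see
  \<open>is_hypergeom_continuation_unique\<close> below); those on the cut are unspecified.
\<close>

definition hypergeom ::
  "nat \<Rightarrow> real \<Rightarrow> (nat \<Rightarrow> real) \<Rightarrow> (nat \<Rightarrow> real) \<Rightarrow> complex \<Rightarrow> complex" where
  "hypergeom q \<sigma> a b = (SOME F. is_hypergeom_continuation q \<sigma> a b F)"

definition univalent_on :: "(complex \<Rightarrow> complex) \<Rightarrow> complex set \<Rightarrow> bool" where
  "univalent_on f S \<longleftrightarrow> f holomorphic_on S \<and> inj_on f S"

text \<open>
  The library predicate \<open>starlike\<close> leaves the centre existentially quantified; here the
  centre is the origin. That the image is a domain follows from univalence.
\<close>

definition starlike_in_disk :: "(complex \<Rightarrow> complex) \<Rightarrow> real \<Rightarrow> bool" where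
  "starlike_in_disk g r \<longleftrightarrow>
     g 0 = 0 \<and> univalent_on g (ball 0 r) \<and>
     (\<forall>w\<in>g ` ball 0 r. closed_segment 0 w \<subseteq> g ` ball 0 r)"

lemma open_slit_plane: "open slit_plane"
proof -
  have "complex_of_real ` {1..} = {z. Im z = 0} \<inter> {z. Re z \<ge> 1}"
    by (auto simp: image_iff complex_eq_iff)
  then show ?thesis
    unfolding slit_plane_def
    by (auto intro!: open_Compl closed_Int closed_Collect_eq closed_Collect_le continuous_intros)
qed

lemma connected_slit_plane: "connected slit_plane"
proof -
  have "closed_segment 0 z \<subseteq> slit_plane" if z: "z \<in> slit_plane" for z
  proof
    fix w assume "w \<in> closed_segment 0 z"
    then obtain u where u: "0 \<le> u" "u \<le> 1" "w = complex_of_real u * z"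
      by (auto simp: closed_segment_def scaleR_conv_of_real)
    show "w \<in> slit_plane"
    proof (rule ccontr)
      assume "w \<notin> slit_plane"
      then obtain t where t: "t \<ge> 1" "complex_of_real u * z = complex_of_real t"
        using u by (auto simp: slit_plane_def)
      have "u \<noteq> 0" using t by auto
      then have "z = complex_of_real (t / u)" "t / u \<ge> 1"
        using t u by (auto simp: field_simps)
      then have "z \<in> complex_of_real ` {1..}" by blast
      then show False using z by (simp add: slit_plane_def)
    qed
  qed
  moreover have "0 \<in> slit_plane"
    by (auto simp: slit_plane_def)
  ultimately have "starlike slit_plane"
    by (auto simp: starlike_def)
  then show ?thesis
    by (rule starlike_imp_connected)
qed

lemma is_hypergeom_continuation_unique:
  assumes F: "is_hypergeom_continuation q \<sigma> a b F"
    and G: "is_hypergeom_continuation q \<sigma> a b G"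
    and z: "z \<in> slit_plane"
  shows "F z = G z"
proof -
  have sub: "ball 0 1 \<subseteq> slit_plane"
    by (auto simp: slit_plane_def)
  have "F w = G w" if "w \<in> ball 0 1" for w
    using F G that unfolding is_hypergeom_continuation_def by (blast intro: sums_unique2)
  then show ?thesis
    using analytic_continuation_open[of "ball 0 1" slit_plane F G z]
      open_slit_plane connected_slit_plane sub F G z
    unfolding is_hypergeom_continuation_def by auto
qed

end

theory Submission
  imports Defs "HOL-Real_Asymp.Real_Asymp"
begin

text \<open>
  The coefficients are the moments of a positive measure \<open>\<nu>\<close> on \<open>[0, 1]\<close>: weak supermajorization
  makes \<open>n \<mapsto> \<Prod>i. (b i + n) / (a i + n)\<close> a moment sequence, and the coefficients are limits of
  normalized products of its shifts. Hence the function is the Stieltjes transform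
  \<open>F z = \<integral> 1 / (1 - t z) d\<nu>(t)\<close>. The difference quotients of \<open>F\<close> and of \<open>z F z\<close> at points
  \<open>z\<close>, \<open>w\<close> are integrals of nonnegative multiples of \<open>1 / ((1 - t z) (1 - t w))\<close>, whose values lie
  in a common open half-plane when \<open>Re z, Re w < 1\<close>. For starlikeness let \<open>u = 1 / (1 - t z)\<close>
  and \<open>\<integral>u = p + \<i> q\<close>, where \<open>Im z > 0\<close>; one needs \<open>Re ((\<integral>u\<^sup>2) * cnj (\<integral>u)) \<ge> 0\<close>. Adding to
  \<open>q * Re (u\<^sup>2 * cnj (\<integral>u))\<close> the Lagrange term \<open>p * Im (u * cnj (\<integral>u))\<close>, whose integral is \<open>0\<close>,
  makes the integrand nonnegative for every \<open>t\<close> when \<open>\<bar>z\<bar> \<le> r*\<close>. Measures are replaced by finite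
  sums throughout, and Montel's theorem provides the limit.
\<close>

subsection \<open>Moment sequences\<close>

text \<open>A list of pairs \<open>(w, t)\<close> stands for the measure with mass \<open>w\<close>
  at \<open>t\<close>, so appending lists adds measures. The integrand may take values in any real
  vector space, so that real moments and complex kernels are treated alike.\<close>

definition discrete_sum :: "(real \<times> real) list \<Rightarrow> (real \<Rightarrow> 'a::real_vector) \<Rightarrow> 'a" where
  "discrete_sum xs \<phi> = (\<Sum>(w, t)\<leftarrow>xs. w *\<^sub>R \<phi> t)"

definition weighted_nodes :: "(real \<times> real) list \<Rightarrow> bool" where
  "weighted_nodes xs \<longleftrightarrow> (\<forall>(w, t)\<in>set xs. 0 \<le> w \<and> 0 \<le> t \<and> t \<le> 1)"

lemma discrete_sum_simps [simp]:
  "discrete_sum [] \<phi> = 0"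
  "discrete_sum (x # xs) \<phi> = fst x *\<^sub>R \<phi> (snd x) + discrete_sum xs \<phi>"
  "discrete_sum (xs @ ys) \<phi> = discrete_sum xs \<phi> + discrete_sum ys \<phi>"
  by (simp_all add: discrete_sum_def split_beta)

lemma weighted_nodes_simps [simp]:
  "weighted_nodes []"
  "weighted_nodes (x # xs) \<longleftrightarrow> 0 \<le> fst x \<and> 0 \<le> snd x \<and> snd x \<le> 1 \<and> weighted_nodes xs"
  "weighted_nodes (xs @ ys) \<longleftrightarrow> weighted_nodes xs \<and> weighted_nodes ys"
  by (auto simp: weighted_nodes_def)

lemma discrete_sum_zero [simp]: "discrete_sum xs (\<lambda>t. 0) = 0"
  by (induction xs) simp_all

lemma discrete_sum_bounded_linear:
  assumes "bounded_linear h"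
  shows "h (discrete_sum xs \<phi>) = discrete_sum xs (\<lambda>t. h (\<phi> t))"
proof -
  interpret bounded_linear h by fact
  show ?thesis by (induction xs) (simp_all add: zero add scale)
qed

lemma discrete_sum_diff: "discrete_sum xs \<phi> - discrete_sum xs \<psi> = discrete_sum xs (\<lambda>t. \<phi> t - \<psi> t)"
  by (induction xs) (simp_all add: algebra_simps)

lemma discrete_sum_add: "discrete_sum xs \<phi> + discrete_sum xs \<psi> = discrete_sum xs (\<lambda>t. \<phi> t + \<psi> t)"
  by (induction xs) (simp_all add: algebra_simps)

lemma discrete_sum_mult_left:
  fixes c :: "'a::real_normed_algebra"
  shows "c * discrete_sum xs \<phi> = discrete_sum xs (\<lambda>t. c * \<phi> t)"
  by (rule discrete_sum_bounded_linear) (rule bounded_linear_mult_right)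

lemma discrete_sum_cong:
  assumes "weighted_nodes xs" "\<And>t. 0 \<le> t \<Longrightarrow> t \<le> 1 \<Longrightarrow> \<phi> t = \<psi> t"
  shows "discrete_sum xs \<phi> = discrete_sum xs \<psi>"
  using assms by (induction xs) auto

lemma discrete_sum_mono:
  fixes \<phi> \<psi> :: "real \<Rightarrow> real"
  assumes "weighted_nodes xs" "\<And>t. 0 \<le> t \<Longrightarrow> t \<le> 1 \<Longrightarrow> \<phi> t \<le> \<psi> t"
  shows "discrete_sum xs \<phi> \<le> discrete_sum xs \<psi>"
  using assms by (induction xs) (auto intro!: add_mono mult_left_mono)

lemma discrete_sum_nonneg:
  fixes \<phi> :: "real \<Rightarrow> real"
  assumes "weighted_nodes xs" "\<And>t. 0 \<le> t \<Longrightarrow> t \<le> 1 \<Longrightarrow> 0 \<le> \<phi> t"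
  shows "0 \<le> discrete_sum xs \<phi>"
  using discrete_sum_mono[of xs "\<lambda>_. 0" \<phi>] assms by simp

lemma norm_discrete_sum_le:
  fixes \<phi> :: "real \<Rightarrow> 'a::real_normed_vector"
  assumes "weighted_nodes xs" "\<And>t. 0 \<le> t \<Longrightarrow> t \<le> 1 \<Longrightarrow> norm (\<phi> t) \<le> C"
  shows "norm (discrete_sum xs \<phi>) \<le> C * discrete_sum xs (\<lambda>t. 1)"
  using assms
proof (induction xs)
  case (Cons x xs)
  have "norm (discrete_sum (x # xs) \<phi>) \<le> norm (fst x *\<^sub>R \<phi> (snd x)) + norm (discrete_sum xs \<phi>)"
    by (simp only: discrete_sum_simps norm_triangle_ineq)
  also have "\<dots> \<le> fst x * C + C * discrete_sum xs (\<lambda>t. 1)"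
    using Cons by (intro add_mono) (auto intro!: mult_left_mono)
  finally show ?case by (simp add: algebra_simps)
qed simp

text \<open>The multiplicative convolution: the image of the product measure under multiplication of
  nodes. Its moments are the products of the moments.\<close>

definition discrete_product :: "(real \<times> real) list \<Rightarrow> (real \<times> real) list \<Rightarrow> (real \<times> real) list" where
  "discrete_product xs ys = concat (map (\<lambda>(w, t). map (\<lambda>(v, s). (w * v, t * s)) ys) xs)"

lemma weighted_nodes_product:
  "weighted_nodes xs \<Longrightarrow> weighted_nodes ys \<Longrightarrow> weighted_nodes (discrete_product xs ys)"
  by (force simp: weighted_nodes_def discrete_product_def mult_le_one)

lemma discrete_sum_product:
  "discrete_sum (discrete_product xs ys) (\<lambda>t. t ^ n) =
     discrete_sum xs (\<lambda>t. t ^ n) * discrete_sum ys (\<lambda>t. t ^ n :: real)"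
proof (induction xs)
  case (Cons x xs)
  have "discrete_sum (map (\<lambda>(v, s). (w * v, t * s)) ys) (\<lambda>t. t ^ n) =
      w * t ^ n * discrete_sum ys (\<lambda>t. t ^ n :: real)" for w t
    by (induction ys) (auto simp: algebra_simps power_mult_distrib)
  from this[of "fst x" "snd x"] Cons show ?case
    by (simp add: discrete_product_def ring_distribs split_beta)
qed (simp add: discrete_product_def)

text \<open>
  By Hausdorff's theorem these are exactly the moment sequences of the finite positive measures
  on \<open>[0, 1]\<close>; the limit measure itself is never needed.
\<close>

definition moment_seq :: "(nat \<Rightarrow> real) \<Rightarrow> bool" where
  "moment_seq c \<longleftrightarrow> (\<exists>xs. (\<forall>N. weighted_nodes (xs N)) \<and>
     (\<forall>n. (\<lambda>N. discrete_sum (xs N) (\<lambda>t. t ^ n)) \<longlonglongrightarrow> c n))"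

lemma moment_seq_discrete: "weighted_nodes xs \<Longrightarrow> moment_seq (\<lambda>n. discrete_sum xs (\<lambda>t. t ^ n))"
  unfolding moment_seq_def by (intro exI[of _ "\<lambda>_. xs"]) auto

lemma moment_seq_const: "0 \<le> c \<Longrightarrow> moment_seq (\<lambda>n. c)"
  using moment_seq_discrete[of "[(c, 1)]"] by simp

lemma moment_seq_add:
  assumes "moment_seq c" "moment_seq d"
  shows "moment_seq (\<lambda>n. c n + d n)"
proof -
  obtain xs ys where "\<forall>N. weighted_nodes (xs N)" "\<forall>n. (\<lambda>N. discrete_sum (xs N) (\<lambda>t. t ^ n)) \<longlonglongrightarrow> c n"
    "\<forall>N. weighted_nodes (ys N)" "\<forall>n. (\<lambda>N. discrete_sum (ys N) (\<lambda>t. t ^ n)) \<longlonglongrightarrow> d n"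
    using assms unfolding moment_seq_def by auto
  then show ?thesis unfolding moment_seq_def
    by (intro exI[of _ "\<lambda>N. xs N @ ys N"]) (auto intro!: tendsto_add)
qed

lemma moment_seq_mult:
  assumes "moment_seq c" "moment_seq d"
  shows "moment_seq (\<lambda>n. c n * d n)"
proof -
  obtain xs ys where "\<forall>N. weighted_nodes (xs N)" "\<forall>n. (\<lambda>N. discrete_sum (xs N) (\<lambda>t. t ^ n)) \<longlonglongrightarrow> c n"
    "\<forall>N. weighted_nodes (ys N)" "\<forall>n. (\<lambda>N. discrete_sum (ys N) (\<lambda>t. t ^ n)) \<longlonglongrightarrow> d n"
    using assms unfolding moment_seq_def by auto
  then show ?thesis unfolding moment_seq_def
    by (intro exI[of _ "\<lambda>N. discrete_product (xs N) (ys N)"])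
       (auto simp: discrete_sum_product weighted_nodes_product intro!: tendsto_mult)
qed

lemma moment_seq_prod:
  "(\<And>i. i \<in> I \<Longrightarrow> moment_seq (c i)) \<Longrightarrow> moment_seq (\<lambda>n. \<Prod>i\<in>I. c i n)"
  by (induction I rule: infinite_finite_induct) (auto intro: moment_seq_const moment_seq_mult)

text \<open>A diagonal choice: the \<open>M\<close>-th list matches the moments of
  \<open>c M\<close> of order at most \<open>M\<close> with error below \<open>1 / (M + 1)\<close>,
  and each fixed order is eventually covered.\<close>

lemma moment_seq_limit:
  assumes c: "\<And>M. moment_seq (c M)" and lim: "\<And>n. (\<lambda>M. c M n) \<longlonglongrightarrow> d n"
  shows "moment_seq d"
proof -
  have "\<exists>xs. weighted_nodes xs \<and> (\<forall>n\<le>M. \<bar>discrete_sum xs (\<lambda>t. t ^ n) - c M n\<bar> < inverse (real (Suc M)))" for M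
  proof -
    obtain xs where xs: "\<And>N. weighted_nodes (xs N)"
      "\<And>n. (\<lambda>N. discrete_sum (xs N) (\<lambda>t. t ^ n)) \<longlonglongrightarrow> c M n"
      using c[of M] unfolding moment_seq_def by auto
    have "eventually (\<lambda>N. \<bar>discrete_sum (xs N) (\<lambda>t. t ^ n) - c M n\<bar> < inverse (real (Suc M))) sequentially" for n
      using tendstoD[OF xs(2)[of n], of "inverse (real (Suc M))"] by (simp add: dist_real_def)
    then have "eventually (\<lambda>N. \<forall>n\<in>{..M}. \<bar>discrete_sum (xs N) (\<lambda>t. t ^ n) - c M n\<bar> < inverse (real (Suc M))) sequentially"
      by (intro eventually_ball_finite) auto
    then obtain N where "\<forall>n\<in>{..M}. \<bar>discrete_sum (xs N) (\<lambda>t. t ^ n) - c M n\<bar> < inverse (real (Suc M))"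
      using eventually_happens trivial_limit_sequentially by blast
    then show ?thesis using xs(1) by auto
  qed
  then obtain ys where ys: "\<And>M. weighted_nodes (ys M)"
    "\<And>M n. n \<le> M \<Longrightarrow> \<bar>discrete_sum (ys M) (\<lambda>t. t ^ n) - c M n\<bar> < inverse (real (Suc M))"
    by metis
  have "(\<lambda>M. discrete_sum (ys M) (\<lambda>t. t ^ n)) \<longlonglongrightarrow> d n" for n
  proof -
    have "(\<lambda>M. discrete_sum (ys M) (\<lambda>t. t ^ n) - c M n) \<longlonglongrightarrow> 0"
    proof (rule Lim_null_comparison)
      show "\<forall>\<^sub>F M in sequentially. norm (discrete_sum (ys M) (\<lambda>t. t ^ n) - c M n) \<le> inverse (real (Suc M))"
        using eventually_ge_at_top[of n] by eventually_elim (use ys(2) in \<open>auto intro: less_imp_le\<close>)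
    qed (rule LIMSEQ_inverse_real_of_nat)
    from tendsto_add[OF this lim[of n]] show ?thesis by simp
  qed
  with ys(1) show ?thesis unfolding moment_seq_def by blast
qed

text \<open>A Riemann sum for the integral of \<open>exp (- (a + n) * x)\<close> over the positive half-line.\<close>

lemma moment_seq_inverse:
  assumes "0 < a"
  shows "moment_seq (\<lambda>n. 1 / (a + real n))"
proof (rule moment_seq_limit)
  fix M :: nat
  define h where "h = 1 / real (Suc M)"
  have h: "h > 0" by (simp add: h_def)
  define xs where "xs K = map (\<lambda>k. (h * exp (- h * a) ^ k, exp (- h) ^ k)) [0..<K]" for K :: nat
  have "weighted_nodes (xs K)" for K
    using h by (auto simp: xs_def weighted_nodes_def intro!: power_le_one)
  moreover have "(\<lambda>K. discrete_sum (xs K) (\<lambda>t. t ^ n)) \<longlonglongrightarrow> h / (1 - exp (- h * (a + real n)))" for n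
  proof -
    have "discrete_sum (xs K) (\<lambda>t. t ^ n) = (\<Sum>k<K. h * exp (- h * (a + real n)) ^ k)" for K
    proof (induction K)
      case (Suc K)
      have "exp (- h * a) ^ K * (exp (- h) ^ K) ^ n = exp (- h * (a + real n)) ^ K"
        by (simp add: exp_of_nat_mult[symmetric] mult_exp_exp algebra_simps)
      then have "h * exp (- h * a) ^ K * (exp (- h) ^ K) ^ n = h * exp (- h * (a + real n)) ^ K"
        by (metis mult.assoc)
      with Suc show ?case
        by (simp add: xs_def)
    qed (simp add: xs_def)
    moreover have "(\<lambda>k. h * exp (- h * (a + real n)) ^ k) sums (h * (1 / (1 - exp (- h * (a + real n)))))"
      using h assms by (intro sums_mult geometric_sums) (simp add: mult_pos_pos add_pos_nonneg)
    ultimately show ?thesis by (simp add: sums_def)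
  qed
  ultimately show "moment_seq (\<lambda>n. (1 / real (Suc M)) / (1 - exp (- (1 / real (Suc M)) * (a + real n))))"
    unfolding moment_seq_def h_def[symmetric] by blast
next
  fix n :: nat
  define s where "s = a + real n"
  have "s > 0" using assms by (simp add: s_def)
  then have "(\<lambda>M. (1 / real (Suc M)) / (1 - exp (- (1 / real (Suc M)) * s))) \<longlonglongrightarrow> inverse s"
    by real_asymp
  then show "(\<lambda>M. (1 / real (Suc M)) / (1 - exp (- (1 / real (Suc M)) * (a + real n)))) \<longlonglongrightarrow> 1 / (a + real n)"
    by (simp add: s_def inverse_eq_divide)
qed

text \<open>
  Moving \<open>\<epsilon>\<close> from \<open>a k > b k\<close> to \<open>a l < b l\<close> with \<open>l < k\<close> changes the product by the factor
  \<open>1 + \<epsilon> (a k - a l - \<epsilon>) / ((a l + n) (a k + n))\<close>, a moment sequence; for a suitable \<open>\<epsilon>\<close> one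
  more entry of \<open>a\<close> agrees with \<open>b\<close>. Only \<open>b\<close> stays ordered in the process.
\<close>

lemma moment_seq_ratio:
  fixes a b :: "nat \<Rightarrow> real"
  assumes "\<And>i. i \<in> {1..q} \<Longrightarrow> 0 < a i" "\<And>i. i \<in> {1..q} \<Longrightarrow> 0 < b i"
    and "mono_on {1..q} b"
    and "\<And>k. k \<in> {1..q} \<Longrightarrow> (\<Sum>i=1..k. a i) \<le> (\<Sum>i=1..k. b i)"
  shows "moment_seq (\<lambda>n. \<Prod>i=1..q. (b i + real n) / (a i + real n))"
  using assms
proof (induction "card {i\<in>{1..q}. a i \<noteq> b i}" arbitrary: a rule: less_induct)
  case less
  show ?case
  proof (cases "\<forall>i\<in>{1..q}. a i \<le> b i")
    case True
    have "moment_seq (\<lambda>n. (b i + real n) / (a i + real n))" if i: "i \<in> {1..q}" for i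
    proof -
      have "moment_seq (\<lambda>n. 1 + (b i - a i) * (1 / (a i + real n)))"
        using True less.prems i
        by (intro moment_seq_add moment_seq_mult moment_seq_const moment_seq_inverse) auto
      moreover have "1 + (b i - a i) * (1 / (a i + real n)) = (b i + real n) / (a i + real n)" for n
        using less.prems(1)[OF i] by (simp add: field_simps add_pos_nonneg)
      ultimately show ?thesis by simp
    qed
    then show ?thesis by (rule moment_seq_prod)
  next
    case False
    then obtain k where k: "k \<in> {1..q}" "b k < a k"
      and kmin: "\<And>i. i \<in> {1..q} \<Longrightarrow> i < k \<Longrightarrow> a i \<le> b i"
    proof -
      define P where "P i \<longleftrightarrow> i \<in> {1..q} \<and> b i < a i" for i
      have "\<exists>i. P i" using False by (auto simp: P_def not_le)
      then have "P (LEAST i. P i)" by (rule LeastI_ex)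
      moreover have "\<not> P i" if "i < (LEAST i. P i)" for i
        using not_less_Least[OF that] .
      ultimately show thesis using that[of "LEAST i. P i"] by (auto simp: P_def not_less)
    qed
    \<comment> \<open>Without an earlier deficit of \<open>a\<close>, the excess at \<open>k\<close>
      would violate the partial sum inequality at \<open>k\<close>.\<close>
    have "\<exists>i. i \<in> {1..<k} \<and> a i < b i"
    proof (rule ccontr)
      assume "\<not> ?thesis"
      then have "(\<Sum>i=1..<k. b i) \<le> (\<Sum>i=1..<k. a i)" by (intro sum_mono) (auto simp: not_less)
      moreover have "(\<Sum>i=1..k. f i) = (\<Sum>i=1..<k. f i) + f k" for f :: "nat \<Rightarrow> real"
        using k(1) by (simp add: sum.last_plus add.commute)
      ultimately show False using less.prems(4)[OF k(1)] k(2) by simp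
    qed
    then obtain l where l: "l \<in> {1..<k}" "a l < b l" by blast
    have lq: "l \<in> {1..q}" "l < k" using l(1) k(1) by auto
    have blk: "b l \<le> b k" using less.prems(3) lq k(1) by (auto simp: mono_on_def)
    \<comment> \<open>The largest transfer that leaves entry \<open>l\<close> at most
      \<open>b l\<close> and entry \<open>k\<close> at least \<open>b k\<close>; the smaller gap is
      closed exactly.\<close>
    define \<epsilon> where "\<epsilon> = min (b l - a l) (a k - b k)"
    have eps: "\<epsilon> > 0" "a l + \<epsilon> \<le> b l" "b k \<le> a k - \<epsilon>" using l(2) k(2) by (auto simp: \<epsilon>_def)
    define a' where "a' = a(l := a l + \<epsilon>, k := a k - \<epsilon>)"
    have a'_pos: "0 < a' i" if "i \<in> {1..q}" for i
      using less.prems(1)[OF that] less.prems(2)[OF k(1)] eps lq by (auto simp: a'_def)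
    have step: "moment_seq (\<lambda>n. \<Prod>i=1..q. (b i + real n) / (a' i + real n))"
    proof (rule less.hyps)
      have "{i\<in>{1..q}. a' i \<noteq> b i} \<subseteq> {i\<in>{1..q}. a i \<noteq> b i}"
        using l(2) k(2) by (auto simp: a'_def)
      moreover have "\<exists>i. i \<in> {i\<in>{1..q}. a i \<noteq> b i} \<and> i \<notin> {i\<in>{1..q}. a' i \<noteq> b i}"
        using l(2) k lq by (cases "\<epsilon> = b l - a l") (auto simp: a'_def \<epsilon>_def min_def split: if_splits)
      ultimately have "{i\<in>{1..q}. a' i \<noteq> b i} \<subset> {i\<in>{1..q}. a i \<noteq> b i}"
        by blast
      then show "card {i\<in>{1..q}. a' i \<noteq> b i} < card {i\<in>{1..q}. a i \<noteq> b i}"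
        by (intro psubset_card_mono) auto
    next
      fix j assume j: "j \<in> {1..q}"
      have a'_eq: "a' i = a i + (if i = l then \<epsilon> else 0) - (if i = k then \<epsilon> else 0)" for i
        using lq by (auto simp: a'_def)
      have sum_a': "(\<Sum>i=1..j. a' i) = (\<Sum>i=1..j. a i) + (if l \<le> j then \<epsilon> else 0) - (if k \<le> j then \<epsilon> else 0)"
        using lq k(1) by (simp add: a'_eq sum.distrib sum_subtractf sum.delta)
      show "(\<Sum>i=1..j. a' i) \<le> (\<Sum>i=1..j. b i)"
      \<comment> \<open>Only for these \<open>j\<close> does the partial sum grow; the minimality of
        \<open>k\<close> then allows a comparison entry by entry.\<close>
      proof (cases "l \<le> j \<and> j < k")
        case True
        have "(\<Sum>i=1..j. a i) + \<epsilon> = (\<Sum>i\<in>{1..j} - {l}. a i) + (a l + \<epsilon>)"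
          using True lq by (simp add: sum_diff1)
        also have "\<dots> \<le> (\<Sum>i\<in>{1..j} - {l}. b i) + b l"
          using True k(1) eps by (intro add_mono sum_mono kmin) auto
        also have "\<dots> = (\<Sum>i=1..j. b i)" using True lq by (simp add: sum_diff1)
        finally show ?thesis using sum_a' True by simp
      qed (use sum_a' less.prems(4)[OF j] lq in auto)
    qed (use a'_pos less.prems in auto)
    \<comment> \<open>The coefficient is nonnegative because
      \<open>a l + \<epsilon> \<le> b l \<le> b k \<le> a k - \<epsilon>\<close>; this is where the
      order of \<open>b\<close> enters.\<close>
    have "moment_seq (\<lambda>n. 1 + \<epsilon> * (a k - a l - \<epsilon>) * (1 / (a l + real n)) * (1 / (a k + real n)))"
      using less.prems(1)[OF k(1)] less.prems(1)[OF lq(1)] eps blk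
      by (intro moment_seq_add moment_seq_mult moment_seq_const moment_seq_inverse) auto
    from moment_seq_mult[OF step this] show ?thesis
    proof (rule back_subst[of moment_seq], intro ext)
      fix n
      have pos: "a i + real n > 0" "a' i + real n > 0" if "i \<in> {1..q}" for i
        using less.prems(1)[OF that] a'_pos[OF that] by auto
      have split: "(\<Prod>i=1..q. f i) = f l * f k * (\<Prod>i\<in>{1..q} - {l} - {k}. f i)" for f :: "nat \<Rightarrow> real"
        using lq k(1) prod.remove[of "{1..q}" l f] prod.remove[of "{1..q} - {l}" k f] by auto
      have "1 + \<epsilon> * (a k - a l - \<epsilon>) * (1 / (a l + real n)) * (1 / (a k + real n))
          = ((a' l + real n) * (a' k + real n)) / ((a l + real n) * (a k + real n))"
        using pos[OF lq(1)] pos[OF k(1)] lq by (simp add: a'_def divide_simps) (simp add: algebra_simps)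
      moreover have "(\<Prod>i\<in>{1..q} - {l} - {k}. (b i + real n) / (a' i + real n)) =
          (\<Prod>i\<in>{1..q} - {l} - {k}. (b i + real n) / (a i + real n))"
        by (intro prod.cong) (auto simp: a'_def)
      ultimately show "(\<Prod>i=1..q. (b i + real n) / (a' i + real n)) *
          (1 + \<epsilon> * (a k - a l - \<epsilon>) * (1 / (a l + real n)) * (1 / (a k + real n))) =
          (\<Prod>i=1..q. (b i + real n) / (a i + real n))"
        unfolding split using pos[OF lq(1)] pos[OF k(1)] by simp
    qed
  qed
qed

section \<open>The hypergeometric coefficients as moments\<close>

lemma weak_supermajorized_pos:
  assumes "weak_supermajorized q b a" "i \<in> {1..q}"
  shows "0 < a i" "0 < b i"
proof -
  have "a 1 \<le> a i" "b 1 \<le> b i"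
    using assms unfolding weak_supermajorized_def mono_on_def by auto
  then show "0 < a i" "0 < b i" using assms unfolding weak_supermajorized_def by auto
qed

text \<open>Shifting all parameters by \<open>j\<close> preserves the majorization, so each
  \<open>r j\<close> is a moment sequence. The product of \<open>r j n / r j 0\<close> over
  \<open>j < M\<close> telescopes to the Pochhammer quotient times a factor tending to
  \<open>1\<close>.\<close>

lemma moment_seq_pochhammer:
  assumes "weak_supermajorized q b a"
  shows "moment_seq (\<lambda>n. \<Prod>i=1..q. pochhammer (a i) n / pochhammer (b i) n)"
proof -
  define r where "r j n = (\<Prod>i=1..q. ((b i + real j) + real n) / ((a i + real j) + real n))" for j n :: nat
  note pos = weak_supermajorized_pos[OF assms]
  have r: "moment_seq (r j)" for j
    unfolding r_def
    by (rule moment_seq_ratio)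
       (use assms pos in \<open>auto simp: weak_supermajorized_def mono_on_def sum.distrib add_pos_nonneg\<close>)
  have rpos: "r j n > 0" for j n
    unfolding r_def using pos by (intro prod_pos) (simp add: add_pos_nonneg)
  show ?thesis
  proof (rule moment_seq_limit)
    fix M
    have "moment_seq (\<lambda>n. \<Prod>j<M. (1 / r j 0) * r j n)"
      using r rpos by (intro moment_seq_prod moment_seq_mult moment_seq_const) (auto intro: less_imp_le)
    then show "moment_seq (\<lambda>n. \<Prod>j<M. r j n / r j 0)" by simp
  next
    fix n
    have shift: "(\<Prod>j<M. (x + real j + real n) / (x + real j)) = pochhammer (x + real M) n / pochhammer x n"
      if "x > 0" for x :: real and M
    proof -
      have "(\<Prod>j<M. (x + real j + real n) / (x + real j)) = pochhammer (x + real n) M / pochhammer x M"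
        by (simp add: pochhammer_prod prod_dividef[symmetric] lessThan_atLeast0 add_ac)
      \<comment> \<open>Splitting \<open>pochhammer x (M + n)\<close> after \<open>n\<close> or
        after \<open>M\<close> factors exchanges the roles of \<open>M\<close> and
        \<open>n\<close>.\<close>
      moreover have "pochhammer x n * pochhammer (x + real n) M = pochhammer x M * pochhammer (x + real M) n"
        using pochhammer_product'[of x n M] pochhammer_product'[of x M n] by (simp add: add.commute)
      ultimately show ?thesis
        using pochhammer_pos[OF that, of n] pochhammer_pos[OF that, of M]
        by (simp add: frac_eq_eq mult.commute)
    qed
    have eq: "(\<Prod>j<M. r j n / r j 0) = (\<Prod>i=1..q. (pochhammer (a i) n / pochhammer (b i) n) *
        (pochhammer (b i + real M) n / pochhammer (a i + real M) n))" for M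
    proof -
      have "(\<Prod>j<M. r j n / r j 0) = (\<Prod>j<M. \<Prod>i=1..q. ((b i + real j + real n) / (b i + real j)) /
          ((a i + real j + real n) / (a i + real j)))"
        by (simp add: r_def prod_dividef[symmetric] mult_ac)
      also have "\<dots> = (\<Prod>i=1..q. \<Prod>j<M. ((b i + real j + real n) / (b i + real j)) /
          ((a i + real j + real n) / (a i + real j)))"
        by (rule prod.swap)
      also have "\<dots> = (\<Prod>i=1..q. (pochhammer (b i + real M) n / pochhammer (b i) n) /
          (pochhammer (a i + real M) n / pochhammer (a i) n))"
        by (intro prod.cong refl, subst prod_dividef) (simp add: shift pos del: prod_dividef)
      finally show ?thesis by (simp add: mult_ac)
    qed
    have lim1: "(\<lambda>M. pochhammer (y + real M) n / pochhammer (x + real M) n) \<longlonglongrightarrow> 1" for x y :: real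
    proof -
      have "(\<lambda>M. \<Prod>k\<in>{0..<n}. (y + real M + real k) / (x + real M + real k)) \<longlonglongrightarrow> (\<Prod>k\<in>{0..<n}. 1)"
        by (intro tendsto_prod) real_asymp
      then show ?thesis by (simp add: pochhammer_prod prod_dividef)
    qed
    have "(\<lambda>M. \<Prod>i=1..q. (pochhammer (a i) n / pochhammer (b i) n) *
        (pochhammer (b i + real M) n / pochhammer (a i + real M) n)) \<longlonglongrightarrow>
        (\<Prod>i=1..q. (pochhammer (a i) n / pochhammer (b i) n) * 1)"
      by (intro tendsto_prod tendsto_mult tendsto_const lim1)
    then show "(\<lambda>M. \<Prod>j<M. r j n / r j 0) \<longlonglongrightarrow> (\<Prod>i=1..q. pochhammer (a i) n / pochhammer (b i) n)"
      by (simp only: eq mult_1_right)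
  qed
qed

lemma moment_seq_hypergeom_coeff:
  assumes "weak_supermajorized q b a" "0 < \<sigma>" "\<sigma> \<le> 1"
  shows "moment_seq (hypergeom_coeff q \<sigma> a b)"
proof -
  \<comment> \<open>Since \<open>pochhammer 1 n = fact n\<close>, the remaining factor is a
    Pochhammer quotient of length one, with upper parameter \<open>\<sigma>\<close> and lower
    parameter \<open>1\<close>.\<close>
  have "weak_supermajorized 1 (\<lambda>_. 1) (\<lambda>_. \<sigma>)"
    using assms by (auto simp: weak_supermajorized_def mono_on_def)
  from moment_seq_mult[OF moment_seq_pochhammer[OF this] moment_seq_pochhammer[OF assms(1)]]
  show ?thesis
    by (simp add: hypergeom_coeff_def[abs_def] prod_dividef pochhammer_fact mult_ac)
qed

subsection \<open>Stieltjes transforms and univalence\<close>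

lemma Re_of_real_mult: "Re (of_real r * z) = r * Re z"
  by simp

lemma slit_plane_nonzero:
  assumes "z \<in> slit_plane" "0 \<le> t" "t \<le> 1"
  shows "1 - of_real t * z \<noteq> 0"
proof
  assume *: "1 - of_real t * z = 0"
  then have "t \<noteq> 0" by auto
  with * have "z = of_real (1 / t)" by (simp add: field_simps)
  moreover have "1 / t \<in> {1..}" using assms \<open>t \<noteq> 0\<close> by simp
  ultimately have "z \<in> of_real ` {1..}" by (rule image_eqI)
  then show False using assms(1) by (simp add: slit_plane_def)
qed

text \<open>The kernel is continuous on the compact set \<open>{0..1} \<times> K\<close>, where its
  denominator has no zero.\<close>

lemma slit_plane_kernel_bound:
  assumes "compact K" "K \<subseteq> slit_plane"
  obtains C where "\<And>z t. z \<in> K \<Longrightarrow> 0 \<le> t \<Longrightarrow> t \<le> 1 \<Longrightarrow> norm (1 / (1 - of_real t * z)) \<le> C"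
proof -
  define f where "f p = 1 / (1 - of_real (fst p) * snd p)" for p :: "real \<times> complex"
  have "compact ({0..1::real} \<times> K)" using assms by (intro compact_Times compact_Icc)
  moreover have "continuous_on ({0..1} \<times> K) f"
    unfolding f_def using assms slit_plane_nonzero by (intro continuous_intros) auto
  ultimately have "bounded (f ` ({0..1} \<times> K))"
    by (intro compact_imp_bounded compact_continuous_image)
  then obtain C where C: "\<And>x. x \<in> f ` ({0..1} \<times> K) \<Longrightarrow> norm x \<le> C"
    unfolding bounded_iff by blast
  show thesis
  proof
    fix z t assume "z \<in> K" "0 \<le> t" "t \<le> (1::real)"
    then have "f (t, z) \<in> f ` ({0..1} \<times> K)" by auto
    from C[OF this] show "norm (1 / (1 - of_real t * z)) \<le> C" by (simp add: f_def)
  qed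
qed

section \<open>Analytic continuation of the generating function\<close>

lemma discrete_kernel_deriv:
  assumes "weighted_nodes xs" "z \<in> slit_plane"
  shows "((\<lambda>z. discrete_sum xs (\<lambda>t. 1 / (1 - of_real t * z))) has_field_derivative
    discrete_sum xs (\<lambda>t. of_real t / (1 - of_real t * z)\<^sup>2)) (at z)"
  using assms
proof (induction xs)
  case (Cons x xs)
  have "1 - of_real (snd x) * z \<noteq> 0"
    using Cons.prems by (intro slit_plane_nonzero) auto
  with Cons show ?case
    by (auto intro!: derivative_eq_intros simp: power2_eq_square)
qed simp

lemma discrete_kernel_power_series:
  fixes z :: complex
  assumes "weighted_nodes xs" "norm z < 1"
  shows "(\<lambda>n. of_real (discrete_sum xs (\<lambda>t. t ^ n)) * z ^ n) sums
    discrete_sum xs (\<lambda>t. 1 / (1 - of_real t * z))"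
  using assms
proof (induction xs)
  case (Cons x xs)
  have "norm (of_real (snd x) * z) < 1"
    using Cons.prems mult_le_one[of "snd x" "norm z"] mult_left_le_one_le[of "norm z" "snd x"]
    by (auto simp: norm_mult)
  then have "(\<lambda>n. of_real (fst x) * (of_real (snd x) * z) ^ n) sums
      (of_real (fst x) * (1 / (1 - of_real (snd x) * z)))"
    by (intro sums_mult geometric_sums)
  moreover have "(\<lambda>n. of_real (discrete_sum xs (\<lambda>t. t ^ n)) * z ^ n) sums
      discrete_sum xs (\<lambda>t. 1 / (1 - of_real t * z))"
    using Cons by auto
  ultimately show ?case
    by (auto dest: sums_add simp: algebra_simps power_mult_distrib scaleR_conv_of_real)
qed simp

text \<open>The discrete transforms are uniformly bounded on compact sets, so Montel's theorem gives
  a holomorphic limit along a subsequence. That subsequence becomes the \<open>xs\<close> of the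
  conclusion; moments, transforms and derivatives all converge along it.\<close>

lemma moment_seq_continuation:
  assumes "moment_seq c"
  obtains F xs where "F holomorphic_on slit_plane"
    "\<And>z. z \<in> ball 0 1 \<Longrightarrow> (\<lambda>n. complex_of_real (c n) * z ^ n) sums F z"
    "\<And>N. weighted_nodes (xs N)"
    "\<And>n. (\<lambda>N. discrete_sum (xs N) (\<lambda>t. t ^ n)) \<longlonglongrightarrow> c n"
    "\<And>z. z \<in> slit_plane \<Longrightarrow>
       (\<lambda>N. discrete_sum (xs N) (\<lambda>t. 1 / (1 - of_real t * z))) \<longlonglongrightarrow> F z"
    "\<And>z. z \<in> slit_plane \<Longrightarrow>
       (\<lambda>N. discrete_sum (xs N) (\<lambda>t. of_real t / (1 - of_real t * z)\<^sup>2)) \<longlonglongrightarrow> deriv F z"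
proof -
  obtain xs where xs: "\<And>N. weighted_nodes (xs N)"
    and lim: "\<And>n. (\<lambda>N. discrete_sum (xs N) (\<lambda>t. t ^ n)) \<longlonglongrightarrow> c n"
    using assms unfolding moment_seq_def by auto
  define G where "G N z = discrete_sum (xs N) (\<lambda>t. 1 / (1 - complex_of_real t * z))" for N z
  \<comment> \<open>The total masses are the zeroth moments; they converge and are therefore
    bounded.\<close>
  have "Bseq (\<lambda>N. discrete_sum (xs N) (\<lambda>t. 1 :: real))"
    using convergent_imp_Bseq[OF convergentI[OF lim[of 0]]] by simp
  then obtain M where M: "\<And>N. \<bar>discrete_sum (xs N) (\<lambda>t. 1 :: real)\<bar> \<le> M"
    by (metis BseqE real_norm_def)
  then have M': "discrete_sum (xs N) (\<lambda>t. 1 :: real) \<le> M" for N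
    by (meson abs_le_D1)
  have holG: "G N holomorphic_on slit_plane" for N
    unfolding holomorphic_on_def G_def
    using discrete_kernel_deriv[OF xs] by (meson field_differentiable_at_within field_differentiable_def)
  have "\<exists>B. \<forall>h\<in>range G. \<forall>z\<in>K. norm (h z) \<le> B" if K: "compact K" "K \<subseteq> slit_plane" for K
  proof -
    obtain C where C: "\<And>z t. z \<in> K \<Longrightarrow> 0 \<le> t \<Longrightarrow> t \<le> 1 \<Longrightarrow> norm (1 / (1 - of_real t * z)) \<le> C"
      using slit_plane_kernel_bound[OF K] by blast
    have "norm (G N z) \<le> C * M" if z: "z \<in> K" for N z
    proof -
      \<comment> \<open>At \<open>t = 0\<close> the kernel equals \<open>1\<close>, which gives the
        sign of \<open>C\<close>.\<close>
      have "norm (1 / (1 - of_real 0 * z)) \<le> C" by (rule C) (use z in auto)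
      then have "0 \<le> C" using norm_ge_zero order_trans by blast
      have "norm (G N z) \<le> C * discrete_sum (xs N) (\<lambda>t. 1)"
        unfolding G_def by (rule norm_discrete_sum_le) (use xs C z in auto)
      also have "\<dots> \<le> C * M" using M' \<open>0 \<le> C\<close> by (intro mult_left_mono)
      finally show ?thesis .
    qed
    then show ?thesis by auto
  qed
  with Montel[of slit_plane "range G" G] open_slit_plane holG
  have "\<exists>F r. F holomorphic_on slit_plane \<and> strict_mono r \<and>
      (\<forall>z\<in>slit_plane. (\<lambda>N. G (r N) z) \<longlonglongrightarrow> F z) \<and>
      (\<forall>K. compact K \<longrightarrow> K \<subseteq> slit_plane \<longrightarrow> uniform_limit K (G \<circ> r) F sequentially)"
    by (smt (verit) rangeE subset_refl)
  then obtain F r where F: "F holomorphic_on slit_plane" "strict_mono r"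
    and pw: "\<And>z. z \<in> slit_plane \<Longrightarrow> (\<lambda>N. G (r N) z) \<longlonglongrightarrow> F z"
    and ul: "\<And>K. compact K \<Longrightarrow> K \<subseteq> slit_plane \<Longrightarrow> uniform_limit K (G \<circ> r) F sequentially"
    by blast
  have lim_r: "(\<lambda>N. discrete_sum (xs (r N)) (\<lambda>t. t ^ n)) \<longlonglongrightarrow> c n" for n
    using LIMSEQ_subseq_LIMSEQ[OF lim[of n] F(2)] by (simp add: o_def)
  show thesis
  proof (rule that[of F "xs \<circ> r"])
    fix z :: complex assume "z \<in> ball 0 1"
    then have z: "norm z < 1" and zs: "z \<in> slit_plane"
      by (auto simp: slit_plane_def)
    define f where "f n N = of_real (discrete_sum (xs (r N)) (\<lambda>t. t ^ n)) * z ^ n" for n N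
    have "norm (f n N) \<le> M * norm z ^ n" for n N
    proof -
      have "norm (discrete_sum (xs (r N)) (\<lambda>t. t ^ n)) \<le> 1 * discrete_sum (xs (r N)) (\<lambda>t. 1 :: real)"
        by (rule norm_discrete_sum_le) (auto simp: xs power_le_one)
      also have "\<dots> \<le> M" using M' by simp
      finally show ?thesis by (simp add: f_def norm_mult norm_power mult_right_mono)
    qed
    \<comment> \<open>Tannery's theorem with majorant \<open>M * norm z ^ n\<close> exchanges the
      limit in \<open>N\<close> with the power series.\<close>
    then have "summable (\<lambda>n. norm (of_real (c n) * z ^ n)) \<and>
        (\<lambda>N. suminf (\<lambda>n. f n N)) \<longlonglongrightarrow> suminf (\<lambda>n. of_real (c n) * z ^ n)"
      using tannerys_theorem[of f "\<lambda>n. of_real (c n) * z ^ n" sequentially "\<lambda>n. M * norm z ^ n"] z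
      unfolding f_def
      by (force intro!: tendsto_intros lim_r summable_mult summable_geometric always_eventually)
    moreover have "suminf (\<lambda>n. f n N) = G (r N) z" for N
      using discrete_kernel_power_series[OF xs z, of "r N"] by (simp add: f_def G_def sums_iff)
    ultimately show "(\<lambda>n. complex_of_real (c n) * z ^ n) sums F z"
      using pw[OF zs] LIMSEQ_unique summable_norm_cancel by (metis (no_types, lifting) ext summable_sums)
  next
    fix z assume z: "z \<in> slit_plane"
    then obtain e where e: "e > 0" "cball z e \<subseteq> slit_plane"
      using open_slit_plane open_contains_cball by blast
    have "uniform_limit (cball z e) (G \<circ> r) F sequentially"
      using e by (intro ul) auto
    then have "uniform_limit (ball z e) (G \<circ> r) F sequentially"
      by (rule uniform_limit_on_subset) auto
    then have "(\<lambda>N. deriv ((G \<circ> r) N) z) \<longlonglongrightarrow> deriv F z"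
      using e ball_subset_cball holG
      by (intro deriv_complex_uniform_limit[where A = "ball z e"]) (auto simp: o_def intro!: always_eventually holomorphic_on_subset[OF holG])
    moreover have "deriv ((G \<circ> r) N) z = discrete_sum (xs (r N)) (\<lambda>t. of_real t / (1 - of_real t * z)\<^sup>2)" for N
      using DERIV_imp_deriv[OF discrete_kernel_deriv[OF xs z]] by (simp add: G_def[abs_def])
    ultimately show "(\<lambda>N. discrete_sum ((xs \<circ> r) N) (\<lambda>t. of_real t / (1 - of_real t * z)\<^sup>2)) \<longlonglongrightarrow> deriv F z"
      by simp
  qed (use F xs lim_r pw in \<open>auto simp: G_def\<close>)
qed

text \<open>
  With \<open>A = 1 - z\<close> and \<open>B = 1 - w\<close> the product equals
  \<open>(1 - t)\<^sup>2 + t (1 - t) (A + B) + t\<^sup>2 A B\<close>, and multiplication by \<open>cnj (A + B)\<close> moves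
  \<open>1\<close>, \<open>A + B\<close> and \<open>A B\<close> into the right half-plane.
\<close>

lemma kernel_product_half_plane:
  assumes "Re z < 1" "Re w < 1"
  obtains \<eta> \<delta> where "0 < \<delta>"
    "\<And>t. 0 \<le> t \<Longrightarrow> t \<le> 1 \<Longrightarrow> \<delta> \<le> Re (\<eta> / ((1 - of_real t * z) * (1 - of_real t * w)))"
proof -
  define A B where "A = 1 - z" and "B = 1 - w"
  have AB: "Re A > 0" "Re B > 0" using assms by (auto simp: A_def B_def)
  define \<eta> where "\<eta> = A + B"
  define m where "m = Min {Re \<eta>, (norm \<eta>)\<^sup>2, Re (cnj \<eta> * (A * B))}"
  define C where "C = (1 + norm z) * (1 + norm w)"
  have eta: "Re \<eta> > 0" using AB by (simp add: \<eta>_def)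
  then have "\<eta> \<noteq> 0" by auto
  have "Re (cnj \<eta> * (A * B)) = (norm A)\<^sup>2 * Re B + (norm B)\<^sup>2 * Re A"
    unfolding cmod_power2 by (simp add: \<eta>_def power2_eq_square algebra_simps)
  also have "\<dots> > 0" using AB by (intro add_pos_pos mult_pos_pos) auto
  finally have "m > 0" using eta \<open>\<eta> \<noteq> 0\<close> by (simp add: m_def)
  have C: "C > 0" unfolding C_def by (intro mult_pos_pos add_pos_nonneg) auto
  show thesis
  proof
    \<comment> \<open>\<open>Re (\<eta> / X)\<close> is \<open>Re (cnj \<eta> * X)\<close> divided
      by \<open>(norm X)\<^sup>2\<close>. The factor \<open>3 / 4\<close> is the minimum of
      \<open>1 - t + t\<^sup>2\<close>, and \<open>C\<close> bounds \<open>norm X\<close>.\<close>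
    show "0 < 3 / 4 * m / C\<^sup>2" using \<open>m > 0\<close> C by simp
    fix t :: real assume t: "0 \<le> t" "t \<le> 1"
    define X where "X = (1 - of_real t * z) * (1 - of_real t * w)"
    have "X = of_real ((1 - t)\<^sup>2) + of_real (t * (1 - t)) * \<eta> + of_real (t\<^sup>2) * (A * B)"
      by (simp add: X_def \<eta>_def A_def B_def power2_eq_square algebra_simps)
    then have "cnj \<eta> * X = of_real ((1 - t)\<^sup>2) * cnj \<eta> + of_real (t * (1 - t)) * (\<eta> * cnj \<eta>)
        + of_real (t\<^sup>2) * (cnj \<eta> * (A * B))"
      by (simp only: distrib_left mult_ac)
    then have "Re (cnj \<eta> * X) = (1 - t)\<^sup>2 * Re \<eta> + (t * (1 - t)) * (norm \<eta>)\<^sup>2 + t\<^sup>2 * Re (cnj \<eta> * (A * B))"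
      by (simp only: complex_norm_square[symmetric] plus_complex.sel Re_of_real_mult Re_complex_of_real cnj.sel)
    also have "\<dots> \<ge> (1 - t)\<^sup>2 * m + (t * (1 - t)) * m + t\<^sup>2 * m"
      using t by (intro add_mono mult_left_mono) (auto simp: m_def)
    also have "(1 - t)\<^sup>2 * m + (t * (1 - t)) * m + t\<^sup>2 * m = (3 / 4 + (t - 1 / 2)\<^sup>2) * m"
      by (simp add: power2_eq_square field_simps)
    finally have "(3 / 4 + (t - 1 / 2)\<^sup>2) * m \<le> Re (cnj \<eta> * X)" .
    moreover have "3 / 4 * m \<le> (3 / 4 + (t - 1 / 2)\<^sup>2) * m"
      using \<open>m > 0\<close> by (intro mult_right_mono) auto
    ultimately have ge: "3 / 4 * m \<le> Re (cnj \<eta> * X)" by linarith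
    have "norm (1 - of_real t * v) \<le> 1 + norm v" for v :: complex
      using norm_triangle_ineq4[of 1 "of_real t * v"] t mult_left_le_one_le[of "norm v" t]
      by (simp add: norm_mult)
    then have "norm X \<le> C"
      unfolding X_def C_def norm_mult by (intro mult_mono) auto
    then have "(norm X)\<^sup>2 \<le> C\<^sup>2" by (simp add: power_mono)
    have "X \<noteq> 0" using ge \<open>m > 0\<close> by auto
    then have Xpos: "(norm X)\<^sup>2 > 0" by simp
    have "3 / 4 * m / C\<^sup>2 \<le> 3 / 4 * m / (norm X)\<^sup>2"
      using \<open>(norm X)\<^sup>2 \<le> C\<^sup>2\<close> Xpos \<open>m > 0\<close> by (intro divide_left_mono mult_pos_pos) (use C in auto)
    also have "\<dots> \<le> Re (cnj \<eta> * X) / (norm X)\<^sup>2"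
      using ge by (intro divide_right_mono) auto
    also have "\<dots> = Re (\<eta> / X)"
      unfolding Re_divide cmod_power2 by (simp add: algebra_simps)
    finally show "3 / 4 * m / C\<^sup>2 \<le> Re (\<eta> / ((1 - of_real t * z) * (1 - of_real t * w)))"
      by (simp add: X_def)
  qed
qed

text \<open>
  The two difference quotients of the Stieltjes transform correspond to \<open>p t = t\<close> and \<open>p t = 1\<close>.
\<close>

lemma half_plane_limit_nonzero:
  assumes "Re z < 1" "Re w < 1" and xs: "\<And>N. weighted_nodes (xs N)"
    and p: "\<And>t. 0 \<le> t \<Longrightarrow> 0 \<le> p t"
    and L: "(\<lambda>N. discrete_sum (xs N) p) \<longlonglongrightarrow> L" "L > 0"
    and D: "(\<lambda>N. discrete_sum (xs N) (\<lambda>t. of_real (p t) / ((1 - of_real t * z) * (1 - of_real t * w))))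
      \<longlonglongrightarrow> D"
  shows "D \<noteq> 0"
proof
  assume "D = 0"
  obtain \<eta> \<delta> where \<delta>: "0 < \<delta>"
    "\<And>t. 0 \<le> t \<Longrightarrow> t \<le> 1 \<Longrightarrow> \<delta> \<le> Re (\<eta> / ((1 - of_real t * z) * (1 - of_real t * w)))"
    using kernel_product_half_plane[OF assms(1,2)] by blast
  define k where "k t = (1 - of_real t * z) * (1 - of_real t * w)" for t
  \<comment> \<open>Because \<open>\<delta>\<close> is independent of \<open>N\<close>, this bound
    survives the limit; positivity of each term alone would not.\<close>
  have "\<delta> * discrete_sum (xs N) p \<le> Re (\<eta> * discrete_sum (xs N) (\<lambda>t. of_real (p t) / k t))" for N
  proof -
    have "\<delta> * discrete_sum (xs N) p = discrete_sum (xs N) (\<lambda>t. \<delta> * p t)"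
      by (rule discrete_sum_mult_left)
    also have "\<dots> \<le> discrete_sum (xs N) (\<lambda>t. Re (\<eta> * (of_real (p t) / k t)))"
    proof (rule discrete_sum_mono[OF xs])
      fix t :: real assume t: "0 \<le> t" "t \<le> 1"
      have "Re (\<eta> * (of_real (p t) / k t)) = Re (of_real (p t) * (\<eta> / k t))" by (simp add: mult_ac)
      also have "\<dots> = p t * Re (\<eta> / k t)" by (rule Re_of_real_mult)
      finally show "\<delta> * p t \<le> Re (\<eta> * (of_real (p t) / k t))"
        using mult_left_mono[OF \<delta>(2)[OF t] p[OF t(1)]] by (simp add: k_def mult.commute)
    qed
    also have "\<dots> = Re (\<eta> * discrete_sum (xs N) (\<lambda>t. of_real (p t) / k t))"
      by (simp add: discrete_sum_mult_left discrete_sum_bounded_linear[OF bounded_linear_Re])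
    finally show ?thesis .
  qed
  moreover have "(\<lambda>N. \<delta> * discrete_sum (xs N) p) \<longlonglongrightarrow> \<delta> * L"
    by (intro tendsto_intros L)
  moreover have "(\<lambda>N. Re (\<eta> * discrete_sum (xs N) (\<lambda>t. of_real (p t) / k t))) \<longlonglongrightarrow> Re (\<eta> * D)"
    using D unfolding k_def by (intro tendsto_intros)
  ultimately have "\<delta> * L \<le> Re (\<eta> * D)" by (meson LIMSEQ_le)
  then show False using \<delta>(1) L(2) \<open>D = 0\<close> by (simp add: mult_le_0_iff)
qed

section \<open>Univalence in the half-plane\<close>

lemma half_plane_subset_slit_plane: "{z. Re z < 1} \<subseteq> slit_plane"
  by (auto simp: slit_plane_def)

text \<open>Injectivity is the nonvanishing of difference quotients. The total weight
  \<open>L\<close> in \<open>half_plane_limit_nonzero\<close> is the first moment for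
  \<open>F\<close> and the zeroth for \<open>z * F z\<close>, hence the positivity of
  \<open>c 1\<close> and \<open>c 0\<close>.\<close>

lemma stieltjes_univalent:
  assumes F: "F holomorphic_on slit_plane" and xs: "\<And>N. weighted_nodes (xs N)"
    and c: "\<And>n. (\<lambda>N. discrete_sum (xs N) (\<lambda>t. t ^ n)) \<longlonglongrightarrow> c n" "c 0 > 0" "c 1 > 0"
    and lim: "\<And>z. z \<in> slit_plane \<Longrightarrow>
       (\<lambda>N. discrete_sum (xs N) (\<lambda>t. 1 / (1 - of_real t * z))) \<longlonglongrightarrow> F z"
  shows "univalent_on F {z. Re z < 1}" "univalent_on (\<lambda>z. z * F z) {z. Re z < 1}"
proof -
  have hol: "F holomorphic_on {z. Re z < 1}"
    using F half_plane_subset_slit_plane by (rule holomorphic_on_subset)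
  define K where "K t z = 1 / (1 - complex_of_real t * z)" for t z
  have K_lim: "(\<lambda>N. discrete_sum (xs N) (\<lambda>t. K t z)) \<longlonglongrightarrow> F z" if "Re z < 1" for z
    using lim half_plane_subset_slit_plane that by (auto simp: K_def)
  have nz: "1 - of_real t * z \<noteq> 0" if "Re z < 1" "0 \<le> t" "t \<le> 1" for t z
    using slit_plane_nonzero half_plane_subset_slit_plane that by blast
  have "F z \<noteq> F w" if z: "Re z < 1" and w: "Re w < 1" and "z \<noteq> w" for z w
  proof -
    have "(\<lambda>N. (discrete_sum (xs N) (\<lambda>t. K t z) - discrete_sum (xs N) (\<lambda>t. K t w)) / (z - w))
        \<longlonglongrightarrow> (F z - F w) / (z - w)"
      using \<open>z \<noteq> w\<close> by (intro tendsto_intros K_lim z w) auto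
    also have "(\<lambda>N. (discrete_sum (xs N) (\<lambda>t. K t z) - discrete_sum (xs N) (\<lambda>t. K t w)) / (z - w)) =
        (\<lambda>N. discrete_sum (xs N) (\<lambda>t. of_real t / ((1 - of_real t * z) * (1 - of_real t * w))))"
      unfolding discrete_sum_diff discrete_sum_bounded_linear[OF bounded_linear_divide]
      using \<open>z \<noteq> w\<close> nz[OF z] nz[OF w]
      by (intro ext discrete_sum_cong[OF xs]) (simp add: K_def divide_simps, simp add: algebra_simps)
    finally have "(F z - F w) / (z - w) \<noteq> 0"
      using c(1)[of 1] by (intro half_plane_limit_nonzero[OF z w xs, where p = "\<lambda>t. t" and L = "c 1"] c) auto
    then show ?thesis by auto
  qed
  with hol show "univalent_on F {z. Re z < 1}"
    unfolding univalent_on_def inj_on_def by blast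
  have "z * F z \<noteq> w * F w" if z: "Re z < 1" and w: "Re w < 1" and "z \<noteq> w" for z w
  proof -
    have "(\<lambda>N. (z * discrete_sum (xs N) (\<lambda>t. K t z) - w * discrete_sum (xs N) (\<lambda>t. K t w)) / (z - w))
        \<longlonglongrightarrow> (z * F z - w * F w) / (z - w)"
      using \<open>z \<noteq> w\<close> by (intro tendsto_intros K_lim z w) auto
    also have "(\<lambda>N. (z * discrete_sum (xs N) (\<lambda>t. K t z) - w * discrete_sum (xs N) (\<lambda>t. K t w)) / (z - w)) =
        (\<lambda>N. discrete_sum (xs N) (\<lambda>t. of_real 1 / ((1 - of_real t * z) * (1 - of_real t * w))))"
      unfolding discrete_sum_mult_left discrete_sum_diff discrete_sum_bounded_linear[OF bounded_linear_divide]
      using \<open>z \<noteq> w\<close> nz[OF z] nz[OF w]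
      by (intro ext discrete_sum_cong[OF xs]) (simp add: K_def divide_simps, simp add: algebra_simps)
    finally have "(z * F z - w * F w) / (z - w) \<noteq> 0"
      using c(1)[of 0] by (intro half_plane_limit_nonzero[OF z w xs, where p = "\<lambda>_. 1" and L = "c 0"] c) auto
    then show ?thesis by auto
  qed
  with hol show "univalent_on (\<lambda>z. z * F z) {z. Re z < 1}"
    unfolding univalent_on_def inj_on_def by (auto intro!: holomorphic_intros)
qed

subsection \<open>Starlikeness\<close>

text \<open>
  With \<open>\<rho> = 13 sqrt 13 - 46\<close> and \<open>w0 = (sqrt 13 - 3) / 2\<close> (so \<open>w0\<^sup>2 + 3 w0 = 1\<close>), the difference of
  the two sides has the double root \<open>w0\<close>; this is where the radius comes from.
\<close>

lemma starlike_radius_quartic: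
  fixes w :: real
  assumes "0 \<le> w"
  shows "(13 * sqrt 13 - 46) * (1 - 2 * w - w\<^sup>2) \<le> ((1 + w) * (1 - 2 * w))\<^sup>2"
proof -
  define e :: real where "e = (sqrt 13 - 3) / 2"
  have s: "sqrt 13 = 2 * e + 3" by (simp add: e_def field_simps)
  have "(2 * e + 3)\<^sup>2 = 13" unfolding s[symmetric] by simp
  then have e: "e\<^sup>2 + 3 * e = 1" by (simp add: power2_eq_square algebra_simps)
  have "3 \<le> sqrt 13" "sqrt 13 \<le> 5" by (auto intro: real_le_rsqrt real_le_lsqrt)
  then have "0 \<le> e" "e \<le> 1" by (auto simp: e_def)
  \<comment> \<open>The cofactor of the double root has nonnegative coefficients, since
    \<open>0 \<le> e \<le> 1\<close>.\<close>
  then have "0 \<le> (w - e)\<^sup>2 * (4 * w\<^sup>2 + (8 * e + 4) * w + (2 - 2 * e))"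
    using assms by (intro mult_nonneg_nonneg add_nonneg_nonneg) auto
  also have "\<dots> = ((1 + w) * (1 - 2 * w))\<^sup>2 - (13 * (2 * e + 3) - 46) * (1 - 2 * w - w\<^sup>2)"
    using e by algebra
  finally show ?thesis by (simp add: s)
qed

lemma one_minus_mult_pos:
  fixes x t :: real
  assumes "x < 1" "0 \<le> t" "t \<le> 1"
  shows "0 < 1 - t * x"
proof (cases "t = 0")
  case False
  then have "t * x < t * 1" using assms by (intro mult_strict_left_mono) auto
  then show ?thesis using assms by simp
qed simp

lemma starlike_radius_bounds: "0 < 13 * sqrt 13 - 46" "13 * sqrt 13 - 46 < 1"
proof -
  \<comment> \<open>At \<open>46 / 13\<close> and \<open>47 / 13\<close> the function
    \<open>13 * s - 46\<close> takes the values \<open>0\<close> and \<open>1\<close>.\<close>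
  have "sqrt ((46 / 13)\<^sup>2) < sqrt 13" "sqrt 13 < sqrt ((47 / 13)\<^sup>2)"
    by (simp_all only: real_sqrt_less_iff) (simp_all add: power2_eq_square)
  then show "0 < 13 * sqrt 13 - 46" "13 * sqrt 13 - 46 < 1" by simp_all
qed

text \<open>
  Completing the square in \<open>k\<close> reduces this to
  \<open>\<bar>sqrt 2 * y - w * b\<bar> \<le> b\<close>, where \<open>w = sqrt (1 - x)\<close> and \<open>b = \<bar>1 - (x + \<i> y)\<bar>\<close>.
\<close>

lemma starlike_quadratic_unit:
  fixes x y k :: real
  assumes "0 \<le> x" "x \<le> 1" "0 \<le> y" "0 \<le> k" and R: "x\<^sup>2 + y\<^sup>2 \<le> 13 * sqrt 13 - 46"
  shows "0 \<le> 2 * y * (1 - x) * k\<^sup>2 + (x * (1 + (x\<^sup>2 + y\<^sup>2)) - 2 * (x\<^sup>2 + y\<^sup>2)) * k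
    + y * (1 - 2 * x + (x\<^sup>2 + y\<^sup>2))"
proof -
  define \<rho> :: real where "\<rho> = 13 * sqrt 13 - 46"
  define w where "w = sqrt (1 - x)"
  define b where "b = sqrt (w ^ 4 + y\<^sup>2)"
  define d :: real where "d = sqrt 2"
  have d: "d\<^sup>2 = 2" "d \<ge> 0" by (auto simp: d_def)
  have w: "w\<^sup>2 = 1 - x" "0 \<le> w" "w \<le> 1" using assms by (auto simp: w_def)
  have x: "x = 1 - w\<^sup>2" using w by simp
  have b: "b\<^sup>2 = w ^ 4 + y\<^sup>2" "b \<ge> 0" by (auto simp: b_def)
  have b': "b\<^sup>2 = 1 - 2 * x + (x\<^sup>2 + y\<^sup>2)" unfolding b(1) x by algebra
  \<comment> \<open>The square of \<open>d * y \<le> b * (1 + w)\<close>, the upper half of the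
    absolute value bound. Where \<open>2 \<le> (1 + w)\<^sup>2\<close> it holds for every
    \<open>y\<close>; otherwise the radius enters through
    \<open>starlike_radius_quartic\<close>.\<close>
  have main: "2 * y\<^sup>2 \<le> (w ^ 4 + y\<^sup>2) * (1 + w)\<^sup>2"
  proof (cases "1 - 2 * w - w\<^sup>2 \<le> 0")
    case True
    then have "2 \<le> (1 + w)\<^sup>2" by (simp add: power2_eq_square algebra_simps)
    then have "y\<^sup>2 * 2 \<le> (w ^ 4 + y\<^sup>2) * (1 + w)\<^sup>2" by (intro mult_mono) auto
    then show ?thesis by simp
  next
    case False
    have "y\<^sup>2 * (1 - 2 * w - w\<^sup>2) \<le> (\<rho> - (1 - w\<^sup>2)\<^sup>2) * (1 - 2 * w - w\<^sup>2)"
      using R False by (intro mult_right_mono) (auto simp: \<rho>_def x)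
    also have "\<dots> = \<rho> * (1 - 2 * w - w\<^sup>2) - (1 - w\<^sup>2)\<^sup>2 * (1 - 2 * w - w\<^sup>2)" by (simp add: algebra_simps)
    also have "\<dots> \<le> ((1 + w) * (1 - 2 * w))\<^sup>2 - (1 - w\<^sup>2)\<^sup>2 * (1 - 2 * w - w\<^sup>2)"
      using starlike_radius_quartic[OF w(2)] by (simp add: \<rho>_def)
    also have "\<dots> = w ^ 4 * (1 + w)\<^sup>2" by algebra
    finally show ?thesis by (simp add: power2_eq_square algebra_simps)
  qed
  have "(d * y)\<^sup>2 \<le> (b * (1 + w))\<^sup>2"
    using main by (simp add: power_mult_distrib d b(1))
  then have "d * y \<le> b * (1 + w)"
    by (rule power2_le_imp_le) (use w b in auto)
  moreover have "b * w \<le> b + d * y"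
    using mult_left_mono[OF w(3) b(2)] d(2) \<open>0 \<le> y\<close> by (simp add: add_increasing2)
  ultimately have "\<bar>d * y - b * w\<bar> \<le> b" by (simp add: abs_le_iff algebra_simps)
  then have "(d * y - b * w)\<^sup>2 \<le> b\<^sup>2" by (rule abs_le_square_iff[THEN iffD1, OF order_trans]) simp
  then have "2 * y\<^sup>2 - b\<^sup>2 * (1 - w\<^sup>2) \<le> 2 * d * y * b * w"
    using d(1) by (simp add: power2_diff power_mult_distrib algebra_simps)
  moreover have "2 * (x\<^sup>2 + y\<^sup>2) - x * (1 + (x\<^sup>2 + y\<^sup>2)) = 2 * y\<^sup>2 - b\<^sup>2 * (1 - w\<^sup>2)"
    unfolding b(1) x by algebra
  ultimately have m: "(2 * (x\<^sup>2 + y\<^sup>2) - x * (1 + (x\<^sup>2 + y\<^sup>2))) * k \<le> 2 * d * y * b * w * k"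
    using \<open>0 \<le> k\<close> by (metis mult_right_mono)
  \<comment> \<open>The square supplies the quadratic and constant coefficients; by \<open>m\<close>
    its cross term absorbs the linear one.\<close>
  have "0 \<le> y * (d * w * k - b)\<^sup>2" using \<open>0 \<le> y\<close> by simp
  also have "\<dots> = 2 * y * w\<^sup>2 * k\<^sup>2 - 2 * d * y * b * w * k + y * b\<^sup>2"
    by (simp add: power2_diff power_mult_distrib d(1) algebra_simps)
  also have "\<dots> \<le> 2 * y * w\<^sup>2 * k\<^sup>2 - (2 * (x\<^sup>2 + y\<^sup>2) - x * (1 + (x\<^sup>2 + y\<^sup>2))) * k + y * b\<^sup>2"
    using m by simp
  finally show ?thesis unfolding b' w(1) by (simp add: algebra_simps)
qed

text \<open>For \<open>x > 0\<close> and \<open>t > 0\<close>, the expression of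
  \<open>starlike_quadratic_unit\<close> at \<open>(t * x, t * y)\<close> is \<open>t\<close> times
  this one. For \<open>x \<le> 0\<close>, the slope condition \<open>k * (1 - x) \<le> y\<close>
  bounds the constant term below by a multiple of \<open>k\<close>.\<close>

lemma starlike_quadratic:
  fixes x y k t :: real
  assumes "0 \<le> y" "0 \<le> t" "t \<le> 1" "0 \<le> k" and k: "k * (1 - x) \<le> y"
    and R: "x\<^sup>2 + y\<^sup>2 \<le> 13 * sqrt 13 - 46"
  shows "0 \<le> 2 * y * (1 - t * x) * k\<^sup>2 + (x * (1 + t\<^sup>2 * (x\<^sup>2 + y\<^sup>2)) - 2 * t * (x\<^sup>2 + y\<^sup>2)) * k
    + y * (1 - 2 * t * x + t\<^sup>2 * (x\<^sup>2 + y\<^sup>2))" (is "0 \<le> ?Q")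
proof -
  define r where "r = x\<^sup>2 + y\<^sup>2"
  have r: "0 \<le> r" "r < 1" using R starlike_radius_bounds(2) by (auto simp: r_def)
  consider "x \<le> 0" | "t = 0" "x > 0" | "x > 0" "t > 0" using \<open>0 \<le> t\<close> by fastforce
  then show ?thesis
  proof cases
    case 1
    have n: "0 \<le> 1 - 2 * t * x + t\<^sup>2 * r"
    proof -
      have "t * x \<le> 0" using 1 \<open>0 \<le> t\<close> by (simp add: mult_nonneg_nonpos)
      moreover have "0 \<le> t\<^sup>2 * r" using r by simp
      ultimately show ?thesis by simp
    qed
    have "t * (2 * y\<^sup>2) \<le> t * (2 * r)" using \<open>0 \<le> t\<close> by (intro mult_left_mono) (auto simp: r_def)
    moreover have "t\<^sup>2 * r\<^sup>2 \<le> t\<^sup>2 * r" using r by (intro mult_left_mono) (auto simp: power2_eq_square mult_left_le)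
    moreover have "t * x \<le> 0" using 1 \<open>0 \<le> t\<close> by (rule mult_nonneg_nonpos[rotated])
    \<comment> \<open>The preceding three estimates bound the cofactor of \<open>k\<close> below by
      this square.\<close>
    moreover have "0 \<le> (1 - t * r)\<^sup>2" by simp
    ultimately have "0 \<le> 1 - 2 * t * x + t\<^sup>2 * r - 2 * t * y\<^sup>2"
      by (simp add: power2_eq_square algebra_simps)
    then have "0 \<le> k * (1 - 2 * t * x + t\<^sup>2 * r - 2 * t * y\<^sup>2)" using \<open>0 \<le> k\<close> by simp
    also have "\<dots> = k * (1 - x) * (1 - 2 * t * x + t\<^sup>2 * r) + (x * (1 + t\<^sup>2 * r) - 2 * t * r) * k"
      unfolding r_def by algebra
    also have "\<dots> \<le> y * (1 - 2 * t * x + t\<^sup>2 * r) + (x * (1 + t\<^sup>2 * r) - 2 * t * r) * k"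
      using mult_right_mono[OF k n] by simp
    also have "\<dots> \<le> 2 * y * (1 - t * x) * k\<^sup>2 + (y * (1 - 2 * t * x + t\<^sup>2 * r) + (x * (1 + t\<^sup>2 * r) - 2 * t * r) * k)"
      using \<open>t * x \<le> 0\<close> \<open>0 \<le> y\<close> by simp
    finally show ?thesis by (simp add: r_def)
  next
    case 2
    then show ?thesis using assms by simp
  next
    case 3
    have "x\<^sup>2 < 1\<^sup>2" using r unfolding r_def by (smt (verit) one_power2 zero_le_power2)
    then have "x < 1" by (rule power2_less_imp_less) simp
    have "t\<^sup>2 * r \<le> 1 * r" using assms r by (intro mult_right_mono) (auto simp: power_le_one)
    then have "(t * x)\<^sup>2 + (t * y)\<^sup>2 \<le> 13 * sqrt 13 - 46"
      using R by (simp add: r_def power_mult_distrib algebra_simps)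
    then have "0 \<le> 2 * (t * y) * (1 - t * x) * k\<^sup>2
        + (t * x * (1 + ((t * x)\<^sup>2 + (t * y)\<^sup>2)) - 2 * ((t * x)\<^sup>2 + (t * y)\<^sup>2)) * k
        + t * y * (1 - 2 * (t * x) + ((t * x)\<^sup>2 + (t * y)\<^sup>2))"
      using 3 assms \<open>x < 1\<close> by (intro starlike_quadratic_unit) (auto simp: mult_le_one)
    also have "\<dots> = t * ?Q" by algebra
    finally show ?thesis using 3 by (simp add: zero_le_mult_iff)
  qed
qed

lemma Re_less_1_in_radius:
  assumes "(norm z)\<^sup>2 \<le> 13 * sqrt 13 - 46"
  shows "Re z < 1"
proof -
  have "norm z < 1"
    using assms starlike_radius_bounds(2) by (smt (verit) norm_ge_zero one_le_power)
  then show ?thesis using complex_Re_le_cmod[of z] by simp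
qed

text \<open>
  Integrated against a positive measure with \<open>\<integral>u = p + \<i> q\<close>, the term with
  factor \<open>p\<close> vanishes, which leaves \<open>q * Re ((\<integral>u\<^sup>2) * cnj (\<integral>u)) \<ge> 0\<close>.
\<close>

lemma kernel_starlike_pointwise:
  fixes z :: complex
  assumes z: "0 \<le> Im z" "(norm z)\<^sup>2 \<le> 13 * sqrt 13 - 46" and t: "0 \<le> t" "t \<le> 1"
    and pq: "0 < p" "0 \<le> q" "q * (1 - Re z) \<le> p * Im z"
  defines "u \<equiv> 1 / (1 - of_real t * z)"
  shows "0 \<le> q * Re (u\<^sup>2 * cnj (Complex p q)) + p * Im (u * cnj (Complex p q))"
proof -
  define x y where "x = Re z" and "y = Im z"
  define v A where "v = t * y" and "A = 1 - t * x"
  define n where "n = A\<^sup>2 + v\<^sup>2"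
  have xy: "x\<^sup>2 + y\<^sup>2 \<le> 13 * sqrt 13 - 46" using z(2) by (simp add: cmod_power2 x_def y_def)
  have "x < 1" using Re_less_1_in_radius[OF z(2)] by (simp add: x_def)
  then have "A > 0" using t unfolding A_def by (rule one_minus_mult_pos)
  then have n: "n > 0" unfolding n_def by (simp add: add_pos_nonneg)
  have u: "u = Complex (A / n) (v / n)"
    unfolding u_def by (simp add: complex_eq_iff Re_divide Im_divide n_def A_def v_def x_def y_def)
  \<comment> \<open>By homogeneity only the slope of \<open>Complex p q\<close> matters, which
    leaves a quadratic polynomial in \<open>k\<close>.\<close>
  define k where "k = q / p"
  have q: "q = k * p" using pq by (simp add: k_def)
  have "0 \<le> 2 * y * (1 - t * x) * k\<^sup>2 + (x * (1 + t\<^sup>2 * (x\<^sup>2 + y\<^sup>2)) - 2 * t * (x\<^sup>2 + y\<^sup>2)) * k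
      + y * (1 - 2 * t * x + t\<^sup>2 * (x\<^sup>2 + y\<^sup>2))" (is "0 \<le> ?Q")
    using z(1) t xy pq by (intro starlike_quadratic) (auto simp: k_def x_def y_def field_simps)
  then have "0 \<le> p\<^sup>2 * t * ?Q / n\<^sup>2" using t by simp
  also have "p\<^sup>2 * t * ?Q = q * ((A\<^sup>2 - v\<^sup>2) * p + 2 * A * v * q) + p * (v * p - A * q) * n"
    unfolding q n_def A_def v_def by algebra
  also have "\<dots> / n\<^sup>2 = q * Re (u\<^sup>2 * cnj (Complex p q)) + p * Im (u * cnj (Complex p q))"
    using n by (simp add: u power2_eq_square field_simps)
  finally show ?thesis .
qed

lemma Re_inverse_pos: "0 < Re z \<Longrightarrow> 0 < Re (inverse z)"
  by (simp add: add_pos_nonneg)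

text \<open>
  Along the preimage \<open>\<gamma>(s) = f\<inverse>(s w)\<close> of a segment, the derivative of \<open>\<bar>\<gamma>(s)\<bar>\<^sup>2\<close> is a positive
  multiple of \<open>Re (f \<zeta> / (\<zeta> f' \<zeta>))\<close>, so the segment towards \<open>0\<close> cannot leave
  the image of a smaller closed disk.
\<close>

lemma starlike_in_disk_criterion:
  assumes uni: "univalent_on f (ball 0 r)" and f0: "f 0 = 0" and "r > 0"
    and pos: "\<And>z. z \<in> ball 0 r \<Longrightarrow> z \<noteq> 0 \<Longrightarrow> 0 < Re (z * deriv f z / f z)"
  shows "starlike_in_disk f r"
proof -
  have hol: "f holomorphic_on ball 0 r" and inj: "inj_on f (ball 0 r)"
    using uni by (auto simp: univalent_on_def)
  obtain h where h: "h holomorphic_on f ` ball 0 r"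
    "\<And>z. z \<in> ball 0 r \<Longrightarrow> deriv f z * deriv h (f z) = 1"
    "\<And>z. z \<in> ball 0 r \<Longrightarrow> h (f z) = z"
    using holomorphic_has_inverse[OF hol open_ball inj] by blast
  have open_img: "open (f ` ball 0 r)"
    using open_mapping_thm3[OF hol open_ball inj] .
  have cont: "continuous_on (ball 0 r) f" using hol by (rule holomorphic_on_imp_continuous_on)
  have "of_real s * f z \<in> f ` ball 0 r" if z: "z \<in> ball 0 r" and s: "0 \<le> s" "s \<le> 1" for z and s :: real
  proof (rule ccontr)
    assume out: "of_real s * f z \<notin> f ` ball 0 r"
    define D where "D = cball (0 :: complex) (norm z)"
    have Dr: "D \<subseteq> ball 0 r" using z by (auto simp: D_def)
    \<comment> \<open>The parameters from \<open>s\<close> on whose points lie in the image of the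
      closed disk through \<open>z\<close>. The minimum \<open>x\<close> is refuted below by a
      smaller element.\<close>
    define S where "S = {s..1} \<inter> (\<lambda>x. of_real x * f z) -` (f ` D)"
    have "compact (f ` D)"
      by (intro compact_continuous_image continuous_on_subset[OF cont Dr]) (simp add: D_def)
    then have "closed S" unfolding S_def
      by (intro continuous_on_closed_vimage[THEN iffD1, rule_format] continuous_intros compact_imp_closed)
        auto
    have "1 \<in> S" using s by (auto simp: S_def D_def)
    have "bdd_below S" by (rule bdd_belowI[of _ s]) (auto simp: S_def)
    define x where "x = Inf S"
    have "x \<in> S" unfolding x_def
      using \<open>closed S\<close> \<open>1 \<in> S\<close> \<open>bdd_below S\<close> by (intro closed_contains_Inf) auto
    then obtain \<zeta> where \<zeta>: "\<zeta> \<in> D" "of_real x * f z = f \<zeta>" and x: "s \<le> x" "x \<le> 1"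
      by (auto simp: S_def)
    have "\<zeta> \<in> ball 0 r" using \<zeta>(1) Dr by auto
    have "x \<noteq> s" using out \<zeta> \<open>\<zeta> \<in> ball 0 r\<close> by auto
    then have "x > s" "x > 0" using x s by auto
    have "f z \<noteq> 0"
    proof
      assume "f z = 0"
      then have "of_real s * f z = f 0" using f0 by simp
      moreover have "0 \<in> ball 0 r" using \<open>r > 0\<close> by simp
      ultimately show False using out by blast
    qed
    then have "f \<zeta> \<noteq> 0" using \<zeta>(2) \<open>x > 0\<close> by (metis mult_eq_0_iff of_real_eq_0_iff less_irrefl)
    then have "\<zeta> \<noteq> 0" using f0 by auto
    define \<gamma> where "\<gamma> y = h (of_real y * f z)" for y :: real
    define E where "E = f z * deriv h (f \<zeta>)"
    have "(h has_field_derivative deriv h (f \<zeta>)) (at (of_real x * f z))"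
      unfolding \<zeta>(2) using h(1) open_img \<open>\<zeta> \<in> ball 0 r\<close> by (intro holomorphic_derivI) auto
    moreover have "((\<lambda>y. of_real y * f z) has_vector_derivative f z) (at x)"
      unfolding scaleR_conv_of_real[symmetric] by (auto intro!: derivative_eq_intros)
    ultimately have "(\<gamma> has_vector_derivative E) (at x)"
      using field_vector_diff_chain_at[of "\<lambda>y. of_real y * f z" "f z" x h "deriv h (f \<zeta>)"]
      by (simp add: o_def \<gamma>_def[abs_def] E_def)
    then have "((\<lambda>y. \<gamma> y \<bullet> \<gamma> y) has_real_derivative (\<gamma> x \<bullet> E + E \<bullet> \<gamma> x)) (at x)"
      unfolding has_real_derivative_iff_has_vector_derivative has_vector_derivative_def
      by (auto intro!: derivative_eq_intros simp: algebra_simps)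
    moreover have "0 < \<gamma> x \<bullet> E + E \<bullet> \<gamma> x"
    proof -
      have \<gamma>x: "\<gamma> x = \<zeta>" using h(3)[OF \<open>\<zeta> \<in> ball 0 r\<close>] \<zeta>(2) by (simp add: \<gamma>_def)
      have df: "deriv f \<zeta> \<noteq> 0" using h(2)[OF \<open>\<zeta> \<in> ball 0 r\<close>] by auto
      then have dh: "deriv h (f \<zeta>) = 1 / deriv f \<zeta>"
        using h(2)[OF \<open>\<zeta> \<in> ball 0 r\<close>] by (simp add: field_simps)
      have fz: "f z = f \<zeta> / of_real x" using \<zeta>(2) \<open>x > 0\<close> by (simp add: field_simps)
      have "E = of_real (1 / x) * (\<zeta> / (\<zeta> * deriv f \<zeta> / f \<zeta>))"
        using \<open>\<zeta> \<noteq> 0\<close> df \<open>f \<zeta> \<noteq> 0\<close> by (simp add: E_def dh fz)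
      then have "cnj \<zeta> * E = of_real ((norm \<zeta>)\<^sup>2 / x) * inverse (\<zeta> * deriv f \<zeta> / f \<zeta>)"
        using complex_norm_square[of \<zeta>] by (simp add: divide_inverse mult_ac)
      moreover have "0 < Re (inverse (\<zeta> * deriv f \<zeta> / f \<zeta>))"
        using pos[OF \<open>\<zeta> \<in> ball 0 r\<close> \<open>\<zeta> \<noteq> 0\<close>] by (intro Re_inverse_pos)
      ultimately have "0 < Re (cnj \<zeta> * E)"
        using \<open>x > 0\<close> \<open>\<zeta> \<noteq> 0\<close> by (simp only: Re_of_real_mult) simp
      moreover have "\<gamma> x \<bullet> E + E \<bullet> \<gamma> x = 2 * Re (cnj \<zeta> * E)"
        by (simp add: \<gamma>x inner_complex_def algebra_simps)
      ultimately show ?thesis by linarith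
    qed
    ultimately obtain d where d: "d > 0" "\<And>e. 0 < e \<Longrightarrow> e < d \<Longrightarrow> \<gamma> (x - e) \<bullet> \<gamma> (x - e) < \<gamma> x \<bullet> \<gamma> x"
      using DERIV_pos_inc_left by blast
    have "open ((\<lambda>y. of_real y * f z) -` (f ` ball 0 r))"
      using open_img by (intro open_vimage continuous_intros)
    moreover have "x \<in> (\<lambda>y. of_real y * f z) -` (f ` ball 0 r)" using \<zeta>(2) \<open>\<zeta> \<in> ball 0 r\<close> by auto
    ultimately obtain d' where d': "d' > 0" "\<And>y. dist y x < d' \<Longrightarrow> of_real y * f z \<in> f ` ball 0 r"
      unfolding open_dist by blast
    \<comment> \<open>So small that \<open>x - e\<close> stays above \<open>s\<close>, its point
      stays in the open image, and the preimage has smaller modulus.\<close>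
    define e where "e = min (min d d') (x - s) / 2"
    have e: "0 < e" "e < d" "e < d'" "e < x - s" using d(1) d'(1) \<open>x > s\<close> by (auto simp: e_def)
    obtain \<xi> where \<xi>: "\<xi> \<in> ball 0 r" "of_real (x - e) * f z = f \<xi>"
      using d'(2)[of "x - e"] e by (auto simp: dist_real_def)
    have "(norm \<xi>)\<^sup>2 < (norm \<zeta>)\<^sup>2"
      using d(2)[OF e(1,2)] h(3)[OF \<xi>(1)] h(3)[OF \<open>\<zeta> \<in> ball 0 r\<close>] \<xi>(2) \<zeta>(2)
      by (simp add: \<gamma>_def dot_square_norm)
    then have "norm \<xi> < norm \<zeta>" by (rule power2_less_imp_less) simp
    then have "\<xi> \<in> D" using \<zeta>(1) by (auto simp: D_def)
    then have "x - e \<in> S" using e x \<xi>(2) by (auto simp: S_def)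
    then have "x \<le> x - e" unfolding x_def by (intro cInf_lower \<open>bdd_below S\<close>)
    then show False using e by simp
  qed
  then have "\<forall>w\<in>f ` ball 0 r. closed_segment 0 w \<subseteq> f ` ball 0 r"
    by (auto simp: closed_segment_def scaleR_conv_of_real)
  then show ?thesis using uni f0 by (simp add: starlike_in_disk_def)
qed

section \<open>Starlikeness of the Stieltjes transform\<close>

lemma starlike_radius_disk: "ball 0 (sqrt (13 * sqrt 13 - 46)) \<subseteq> {z. Re z < 1}"
proof
  fix z :: complex assume "z \<in> ball 0 (sqrt (13 * sqrt 13 - 46))"
  then have "Re z < sqrt (13 * sqrt 13 - 46)"
    using complex_Re_le_cmod[of z] by simp
  also have "\<dots> < 1" using starlike_radius_bounds by simp
  finally show "z \<in> {z. Re z < 1}" by simp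
qed

text \<open>By the open mapping theorem a nonconstant image contains \<open>f z - e / 2\<close> for
  some \<open>e > 0\<close>, whose real part is nonnegative as well. This restores the strict
  inequality lost in the limit.\<close>

lemma holomorphic_Re_pos:
  assumes "f holomorphic_on S" "open S" "connected S" "\<And>z. z \<in> S \<Longrightarrow> 0 \<le> Re (f z)"
    and "a \<in> S" "0 < Re (f a)" "z \<in> S"
  shows "0 < Re (f z)"
proof (cases "f constant_on S")
  case True
  then show ?thesis using assms(5-7) by (metis constant_on_def)
next
  case False
  have "open (f ` S)"
    using open_mapping_thm[OF assms(1-3) \<open>open S\<close> subset_refl False] .
  then obtain e where e: "e > 0" "ball (f z) e \<subseteq> f ` S"
    using \<open>z \<in> S\<close> openE by blast
  have "f z - of_real (e / 2) \<in> ball (f z) e" using e(1) by (simp add: dist_norm)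
  then obtain y where "y \<in> S" "f z - of_real (e / 2) = f y" using e(2) by blast
  then have "Re (f z) - e / 2 = Re (f y)" "0 \<le> Re (f y)"
    using assms(4) by (auto simp: complex_eq_iff)
  then show ?thesis using e(1) by simp
qed

text \<open>All nodes of positive weight are zeros of \<open>\<phi>\<close>, hence of
  \<open>\<psi>\<close>. This serves the degenerate case of mass only at
  \<open>t = 0\<close>.\<close>

lemma discrete_sum_eq_0D:
  fixes \<phi> :: "real \<Rightarrow> real"
  assumes "weighted_nodes xs" "\<And>t. 0 \<le> t \<Longrightarrow> t \<le> 1 \<Longrightarrow> 0 \<le> \<phi> t" "discrete_sum xs \<phi> = 0"
    and "\<And>t. 0 \<le> t \<Longrightarrow> t \<le> 1 \<Longrightarrow> \<phi> t = 0 \<Longrightarrow> \<psi> t = 0"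
  shows "discrete_sum xs \<psi> = 0"
  using assms
proof (induction xs)
  case (Cons x xs)
  have "0 \<le> discrete_sum xs \<phi>" using Cons.prems by (intro discrete_sum_nonneg) auto
  moreover have "0 \<le> fst x * \<phi> (snd x)" using Cons.prems by auto
  moreover have "fst x * \<phi> (snd x) + discrete_sum xs \<phi> = 0" using Cons.prems(3) by simp
  ultimately have "discrete_sum xs \<phi> = 0" "fst x * \<phi> (snd x) = 0" by linarith+
  with Cons show ?case by auto
qed simp

lemma discrete_kernel_starlike_upper:
  assumes xs: "weighted_nodes xs" and z: "0 < Im z" "(norm z)\<^sup>2 \<le> 13 * sqrt 13 - 46"
  shows "0 \<le> Re (discrete_sum xs (\<lambda>t. (1 / (1 - of_real t * z))\<^sup>2) *
    cnj (discrete_sum xs (\<lambda>t. 1 / (1 - of_real t * z))))"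
proof -
  define u where "u t = 1 / (1 - of_real t * z)" for t
  define p q where "p = Re (discrete_sum xs u)" and "q = Im (discrete_sum xs u)"
  define U W where "U = discrete_sum xs u" and "W = discrete_sum xs (\<lambda>t. (u t)\<^sup>2)"
  have U: "U = Complex p q" by (simp add: U_def p_def q_def)
  have p': "p = discrete_sum xs (\<lambda>t. Re (u t))" and q': "q = discrete_sum xs (\<lambda>t. Im (u t))"
    unfolding p_def q_def
    by (simp_all add: discrete_sum_bounded_linear[OF bounded_linear_Re] discrete_sum_bounded_linear[OF bounded_linear_Im])
  have "Re z < 1" using z(2) by (rule Re_less_1_in_radius)
  have den: "0 < 1 - t * Re z" if "0 \<le> t" "t \<le> 1" for t
    using one_minus_mult_pos[OF \<open>Re z < 1\<close> that] by simp
  define n where "n t = (1 - t * Re z)\<^sup>2 + (t * Im z)\<^sup>2" for t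
  have n: "0 < n t" if "0 \<le> t" "t \<le> 1" for t
    using den[OF that] by (simp add: n_def add_pos_nonneg)
  have u: "Re (u t) = (1 - t * Re z) / n t" "Im (u t) = t * Im z / n t" for t
    by (simp_all add: u_def Re_divide Im_divide n_def)
  have Re_u: "0 \<le> Re (u t)" and Im_u: "0 \<le> Im (u t)" if "0 \<le> t" "t \<le> 1" for t
    using den[OF that] n[OF that] that z(1) by (auto simp: u)
  have "0 \<le> p" "0 \<le> q"
    unfolding p' q' using Re_u Im_u by (auto intro!: discrete_sum_nonneg[OF xs])
  \<comment> \<open>Each \<open>u t\<close> has its argument between \<open>0\<close> and that of
    \<open>1 / (1 - z)\<close>; positive combinations stay in this convex cone.\<close>
  have cone: "q * (1 - Re z) \<le> p * Im z"
  proof -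
    have "discrete_sum xs (\<lambda>t. (1 - Re z) * Im (u t)) \<le> discrete_sum xs (\<lambda>t. Im z * Re (u t))"
    proof (rule discrete_sum_mono[OF xs])
      fix t :: real assume t: "0 \<le> t" "t \<le> 1"
      have "(1 - Re z) * (t * Im z) \<le> Im z * (1 - t * Re z)"
        using mult_right_mono[OF t(2), of "Im z"] z(1) by (simp add: algebra_simps)
      then show "(1 - Re z) * Im (u t) \<le> Im z * Re (u t)"
        using n[OF t] by (simp add: u divide_right_mono)
    qed
    then show ?thesis
      unfolding p' q' discrete_sum_mult_left[symmetric] by (simp only: mult.commute)
  qed
  have "0 \<le> Re (W * cnj U)"
  proof (cases "p = 0 \<or> q = 0")
    case False
    then have "0 < p" "0 < q" using \<open>0 \<le> p\<close> \<open>0 \<le> q\<close> by auto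
    have "0 \<le> discrete_sum xs (\<lambda>t. q * Re ((u t)\<^sup>2 * cnj U) + p * Im (u t * cnj U))"
      unfolding U u_def
      by (intro discrete_sum_nonneg[OF xs] kernel_starlike_pointwise) (use z cone \<open>0 < p\<close> \<open>0 < q\<close> in auto)
    also have "\<dots> = q * Re (W * cnj U) + p * Im (U * cnj U)"
      unfolding discrete_sum_add[symmetric] discrete_sum_mult_left[symmetric] W_def
      unfolding discrete_sum_bounded_linear[OF bounded_linear_Re, symmetric]
        discrete_sum_bounded_linear[OF bounded_linear_Im, symmetric]
        discrete_sum_bounded_linear[OF bounded_linear_mult_left, symmetric]
      by (simp add: U_def)
    also have "Im (U * cnj U) = 0" by (simp add: algebra_simps)
    finally show ?thesis using \<open>0 < q\<close> by (simp add: zero_le_mult_iff)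
  next
    case True
    then show ?thesis
    proof
      assume "p = 0"
      then have "q = 0" using cone \<open>0 \<le> q\<close> \<open>Re z < 1\<close> by (simp add: mult_le_0_iff)
      with \<open>p = 0\<close> show ?thesis by (simp add: U)
    next
      \<comment> \<open>All mass now sits at \<open>t = 0\<close>, where \<open>u t = 1\<close>, so
        the two sums coincide.\<close>
      assume "q = 0"
      have "discrete_sum xs (\<lambda>t. (u t)\<^sup>2 - u t) = 0"
      proof (rule discrete_sum_eq_0D[OF xs])
        show "discrete_sum xs (\<lambda>t. Im (u t)) = 0" using \<open>q = 0\<close> q' by simp
        show "(u t)\<^sup>2 - u t = 0" if t: "0 \<le> t" "t \<le> 1" "Im (u t) = 0" for t
        proof -
          have "t = 0" using t(3) n[OF t(1,2)] z(1) by (simp add: u)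
          then show ?thesis by (simp add: u_def)
        qed
      qed (rule Im_u)
      then have "W = U" by (simp add: discrete_sum_diff[symmetric] W_def U_def)
      then show ?thesis by (simp flip: complex_norm_square)
    qed
  qed
  then show ?thesis by (simp add: W_def U_def u_def[abs_def])
qed

text \<open>Conjugation reduces the lower half-plane to the upper one; on the real axis both sums
  are nonnegative reals.\<close>

lemma discrete_kernel_starlike:
  assumes xs: "weighted_nodes xs" and z: "(norm z)\<^sup>2 \<le> 13 * sqrt 13 - 46"
  shows "0 \<le> Re (discrete_sum xs (\<lambda>t. (1 / (1 - of_real t * z))\<^sup>2) *
    cnj (discrete_sum xs (\<lambda>t. 1 / (1 - of_real t * z))))" (is "0 \<le> ?R z")
proof -
  consider "Im z > 0" | "Im z < 0" | "Im z = 0" by linarith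
  then show ?thesis
  proof cases
    case 1
    then show ?thesis using discrete_kernel_starlike_upper assms by blast
  next
    case 2
    then have "0 \<le> ?R (cnj z)" using discrete_kernel_starlike_upper[OF xs, of "cnj z"] z by simp
    also have "?R (cnj z) = Re (cnj (discrete_sum xs (\<lambda>t. (1 / (1 - of_real t * z))\<^sup>2) *
        cnj (discrete_sum xs (\<lambda>t. 1 / (1 - of_real t * z)))))"
      unfolding complex_cnj_mult discrete_sum_bounded_linear[OF bounded_linear_cnj] by simp
    also have "\<dots> = ?R z" by (simp only: cnj.sel)
    finally show ?thesis .
  next
    case 3
    have "Re z < 1" using z by (rule Re_less_1_in_radius)
    have den: "0 \<le> 1 - t * Re z" if "0 \<le> t" "t \<le> 1" for t
      using one_minus_mult_pos[OF \<open>Re z < 1\<close> that] by simp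
    have "z = of_real (Re z)" using 3 by (simp add: complex_eq_iff)
    then have u: "1 / (1 - of_real t * z) = of_real (1 / (1 - t * Re z))" for t
      by (metis of_real_1 of_real_diff of_real_divide of_real_mult)
    have "0 \<le> discrete_sum xs (\<lambda>t. (1 / (1 - t * Re z))\<^sup>2)" "0 \<le> discrete_sum xs (\<lambda>t. 1 / (1 - t * Re z))"
      using den by (auto intro!: discrete_sum_nonneg[OF xs])
    moreover have "?R z = discrete_sum xs (\<lambda>t. (1 / (1 - t * Re z))\<^sup>2) * discrete_sum xs (\<lambda>t. 1 / (1 - t * Re z))"
      unfolding u of_real_power[symmetric] discrete_sum_bounded_linear[OF bounded_linear_of_real, symmetric]
      by simp
    ultimately show ?thesis by simp
  qed
qed

lemma stieltjes_starlike:
  assumes F: "F holomorphic_on slit_plane" and xs: "\<And>N. weighted_nodes (xs N)"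
    and uni: "univalent_on (\<lambda>z. z * F z) {z. Re z < 1}" and "F 0 = 1"
    and lim: "\<And>z. z \<in> slit_plane \<Longrightarrow>
       (\<lambda>N. discrete_sum (xs N) (\<lambda>t. 1 / (1 - of_real t * z))) \<longlonglongrightarrow> F z"
    and lim': "\<And>z. z \<in> slit_plane \<Longrightarrow>
       (\<lambda>N. discrete_sum (xs N) (\<lambda>t. of_real t / (1 - of_real t * z)\<^sup>2)) \<longlonglongrightarrow> deriv F z"
  shows "starlike_in_disk (\<lambda>z. z * F z) (sqrt (13 * sqrt 13 - 46))"
proof -
  define r where "r = sqrt (13 * sqrt 13 - 46)"
  have r: "0 < r" "r\<^sup>2 = 13 * sqrt 13 - 46"
    using starlike_radius_bounds by (auto simp: r_def)
  have sub: "ball 0 r \<subseteq> {z. Re z < 1}"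
    using starlike_radius_disk by (simp add: r_def)
  then have sub': "ball 0 r \<subseteq> slit_plane" using half_plane_subset_slit_plane by blast
  \<comment> \<open>The derivative of \<open>z * F z\<close>. For the kernel \<open>u\<close> one
    has \<open>u + z * t * u\<^sup>2 = u\<^sup>2\<close>, so \<open>W\<close> is the limit of the
    sums of squared kernels.\<close>
  define W where "W z = F z + z * deriv F z" for z
  \<comment> \<open>A zero of \<open>F\<close> would be a second zero of the injective function
    \<open>z * F z\<close>, since \<open>F 0 = 1\<close>.\<close>
  have nz: "F z \<noteq> 0" if "z \<in> ball 0 r" for z
  proof
    assume "F z = 0"
    then have "z * F z = 0 * F 0" by simp
    moreover have "inj_on (\<lambda>z. z * F z) {z. Re z < 1}" using uni by (simp add: univalent_on_def)
    ultimately have "z = 0" using that sub r(1) by (metis (no_types, lifting) inj_onD mem_Collect_eq subsetD zero_complex.sel(1) zero_less_one)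
    then show False using \<open>F z = 0\<close> \<open>F 0 = 1\<close> by simp
  qed
  have nonneg: "0 \<le> Re (W z / F z)" if z: "z \<in> ball 0 r" for z
  proof -
    have zs: "z \<in> slit_plane" using z sub' by blast
    have "(\<lambda>N. discrete_sum (xs N) (\<lambda>t. 1 / (1 - of_real t * z)) +
        z * discrete_sum (xs N) (\<lambda>t. of_real t / (1 - of_real t * z)\<^sup>2)) \<longlonglongrightarrow> W z"
      unfolding W_def by (intro tendsto_intros lim lim' zs)
    also have "(\<lambda>N. discrete_sum (xs N) (\<lambda>t. 1 / (1 - of_real t * z)) +
        z * discrete_sum (xs N) (\<lambda>t. of_real t / (1 - of_real t * z)\<^sup>2)) =
        (\<lambda>N. discrete_sum (xs N) (\<lambda>t. (1 / (1 - of_real t * z))\<^sup>2))"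
      unfolding discrete_sum_mult_left discrete_sum_add using slit_plane_nonzero[OF zs]
      by (intro ext discrete_sum_cong[OF xs]) (simp add: divide_simps, simp add: power2_eq_square algebra_simps)
    finally have lim_W: "(\<lambda>N. Re (discrete_sum (xs N) (\<lambda>t. (1 / (1 - of_real t * z))\<^sup>2) *
        cnj (discrete_sum (xs N) (\<lambda>t. 1 / (1 - of_real t * z))))) \<longlonglongrightarrow> Re (W z * cnj (F z))"
      by (intro tendsto_intros lim zs)
    have le: "(norm z)\<^sup>2 \<le> 13 * sqrt 13 - 46"
      unfolding r(2)[symmetric] using z by (intro power_mono) auto
    have "0 \<le> Re (W z * cnj (F z))"
      by (rule LIMSEQ_le_const[OF lim_W]) (intro exI allI impI discrete_kernel_starlike[OF xs le])
    then show ?thesis by (subst complex_div_cnj) (simp add: Re_divide_of_real del: times_complex.sel)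
  qed
  have holF: "F holomorphic_on ball 0 r" using F sub' by (rule holomorphic_on_subset)
  have "(\<lambda>z. W z / F z) holomorphic_on ball 0 r"
    unfolding W_def using holF nz by (intro holomorphic_intros holomorphic_deriv) auto
  moreover have "0 < Re (W 0 / F 0)" using \<open>F 0 = 1\<close> by (simp add: W_def)
  moreover have "0 \<in> ball 0 r" using r(1) by simp
  ultimately have pos: "0 < Re (W z / F z)" if "z \<in> ball 0 r" for z
    using holomorphic_Re_pos[of "\<lambda>z. W z / F z" "ball 0 r" 0 z] nonneg that open_ball connected_ball
    by blast
  show ?thesis unfolding r_def[symmetric]
  proof (rule starlike_in_disk_criterion)
    show "univalent_on (\<lambda>z. z * F z) (ball 0 r)"
      unfolding univalent_on_def
      using holomorphic_on_subset[OF _ sub] inj_on_subset[OF _ sub] uni[unfolded univalent_on_def] by blast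
    fix z :: complex assume z: "z \<in> ball 0 r" "z \<noteq> 0"
    have "(F has_field_derivative deriv F z) (at z)"
      using holF z by (intro holomorphic_derivI) auto
    then have "deriv (\<lambda>z. z * F z) z = W z"
      unfolding W_def by (intro DERIV_imp_deriv) (auto intro!: derivative_eq_intros simp: algebra_simps)
    then show "0 < Re (z * deriv (\<lambda>z. z * F z) z / (z * F z))" using pos z by simp
  qed (use r in auto)
qed

section \<open>Transfer from the constructed continuation to \<open>hypergeom\<close>\<close>

lemma univalent_on_cong:
  assumes "\<And>z. z \<in> S \<Longrightarrow> f z = g z"
  shows "univalent_on f S \<longleftrightarrow> univalent_on g S"
  unfolding univalent_on_def using assms holomorphic_cong[OF refl assms] inj_on_cong[of S f g] by simp

lemma starlike_in_disk_cong:
  assumes "\<And>z. z \<in> ball 0 r \<Longrightarrow> f z = g z" "0 < r"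
  shows "starlike_in_disk f r \<longleftrightarrow> starlike_in_disk g r"
proof -
  have "f ` ball 0 r = g ` ball 0 r" "f 0 = g 0" using assms by auto
  moreover have "univalent_on f (ball 0 r) \<longleftrightarrow> univalent_on g (ball 0 r)"
    by (rule univalent_on_cong[OF assms(1)])
  ultimately show ?thesis by (simp only: starlike_in_disk_def)
qed

theorem theorem13:
  fixes q :: nat and a b :: "nat \<Rightarrow> real" and \<sigma> :: real
  assumes "q \<ge> 1"
    and "weak_supermajorized q b a"
    and "0 < \<sigma>" and "\<sigma> \<le> 1"
  shows "univalent_on (\<lambda>z. hypergeom q \<sigma> a b z) {z. Re z < 1} \<and>
         univalent_on (\<lambda>z. z * hypergeom q \<sigma> a b z) {z. Re z < 1} \<and>
         starlike_in_disk (\<lambda>z. z * hypergeom q \<sigma> a b z) (sqrt (13 * sqrt 13 - 46))"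
proof -
  define c where "c = hypergeom_coeff q \<sigma> a b"
  define H where "H = hypergeom q \<sigma> a b"
  obtain F xs where F: "F holomorphic_on slit_plane"
    "\<And>z. z \<in> ball 0 1 \<Longrightarrow> (\<lambda>n. complex_of_real (c n) * z ^ n) sums F z"
    and xs: "\<And>N. weighted_nodes (xs N)"
    and c: "\<And>n. (\<lambda>N. discrete_sum (xs N) (\<lambda>t. t ^ n)) \<longlonglongrightarrow> c n"
    and lim: "\<And>z. z \<in> slit_plane \<Longrightarrow>
       (\<lambda>N. discrete_sum (xs N) (\<lambda>t. 1 / (1 - of_real t * z))) \<longlonglongrightarrow> F z"
      "\<And>z. z \<in> slit_plane \<Longrightarrow>
       (\<lambda>N. discrete_sum (xs N) (\<lambda>t. of_real t / (1 - of_real t * z)\<^sup>2)) \<longlonglongrightarrow> deriv F z"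
    by (rule moment_seq_continuation[OF moment_seq_hypergeom_coeff[OF assms(2-4), folded c_def]])
      (rule that; assumption)
  have contF: "is_hypergeom_continuation q \<sigma> a b F"
    using F by (simp add: is_hypergeom_continuation_def c_def)
  \<comment> \<open>The existence of \<open>F\<close> makes the choice in \<open>hypergeom\<close> a
    genuine continuation, which uniqueness then identifies with \<open>F\<close> on the slit
    plane.\<close>
  then have "is_hypergeom_continuation q \<sigma> a b H"
    unfolding H_def hypergeom_def by (rule someI[of "is_hypergeom_continuation q \<sigma> a b"])
  then have H: "H z = F z" if "z \<in> slit_plane" for z
    using is_hypergeom_continuation_unique contF that by blast
  have "c n > 0" for n
    unfolding c_def hypergeom_coeff_def using assms weak_supermajorized_pos[OF assms(2)]
    by (intro divide_pos_pos mult_pos_pos prod_pos pochhammer_pos) auto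
  note uni = stieltjes_univalent[OF F(1) xs c this this lim(1)]
  have "(\<lambda>n. complex_of_real (c n) * 0 ^ n) sums F 0" using F(2)[of 0] by simp
  moreover have "(\<lambda>n. complex_of_real (c n) * 0 ^ n) sums c 0" by (rule powser_sums_zero)
  ultimately have "F 0 = c 0" by (rule sums_unique2)
  then have "F 0 = 1" by (simp add: c_def hypergeom_coeff_def)
  note star = stieltjes_starlike[OF F(1) xs uni(2) this lim]
  have disk: "ball 0 (sqrt (13 * sqrt 13 - 46)) \<subseteq> slit_plane"
    using starlike_radius_disk half_plane_subset_slit_plane by blast
  have HF: "H z = F z" if "z \<in> {z. Re z < 1}" for z
    using H half_plane_subset_slit_plane that by blast
  have "univalent_on H {z. Re z < 1}"
    using uni(1) univalent_on_cong[of "{z. Re z < 1}" H F, OF HF] by blast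
  moreover have "univalent_on (\<lambda>z. z * H z) {z. Re z < 1}"
    using uni(2) univalent_on_cong[of "{z. Re z < 1}" "\<lambda>z. z * H z" "\<lambda>z. z * F z"] HF by simp
  moreover have "starlike_in_disk (\<lambda>z. z * H z) (sqrt (13 * sqrt 13 - 46))"
  proof (subst starlike_in_disk_cong)
    show "z * H z = z * F z" if "z \<in> ball 0 (sqrt (13 * sqrt 13 - 46))" for z
      using H disk that by auto
  qed (use star starlike_radius_bounds in auto)
  ultimately show ?thesis by (simp add: H_def)
qed

end
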